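(* There is a single combinatorial type $\mathcal{T}$ of $5$-dimensional polytopes such that the following holds. Let $G$ be any $(2\times3)$-game with generic payoffs (as defined in the context), and let $P_G$ be its correlated equilibrium polytope. Then one of the following holds: (i) $P_G$ is a point; (ii) $P_G$ is of maximal dimension $5$ and has combinatorial type $\mathcal{T}$ (so all the $5$-dimensional polytopes $P_G$ arising from generic $(2\times3)$-games $G$ are combinatorially equivalent to each other); (iii) there exists a $(2\times2)$-game $G'$ such that its correlated equilibrium polytope $P_{G'}$ has maximal dimension $3$ and $P_{G'}$ is combinatorially equivalent to $P_G$.
   Context: For a positive integer $m$ write $[m]=\{1,\dots,m\}$. A $(2\times m)$-game is a two-player game given by two real payoff matrices $X^{(1)},X^{(2)}\in\mathbb{R}^{2\times m}$; player 1 has strategies $1,2$ (rows), player 2 has strategies $1,\dots,m$ (columns), and $X^{(i)}_{jk}$ is the payoff of player $i$ when player 1 plays $j$ and player 2 plays $k$. The correlated equilibrium polytope $P_G\subseteq\mathbb{R}^{2m}$ is the set of all $p=(p_{jk})_{j\in[2],k\in[m]}$ with $p_{jk}\ge0$ for all $j,k$, $\sum_{j,k}p_{jk}=1$, and $$\sum_{k=1}^m\big(X^{(1)}_{jk}-X^{(1)}_{j'k}\big)p_{jk}\ge0\ \text{ for all } j,j'\in[2],\qquad \sum_{j=1}^2\big(X^{(2)}_{jk}-X^{(2)}_{jl}\big)p_{jk}\ge0\ \text{ for all } k,l\in[m].$$ The maximal possible dimension of $P_G$ is $2m-1$. For a $(2\times3)$-game define $Y^{(1)}_k(1,2)=X^{(1)}_{1k}-X^{(1)}_{2k}$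 for $k\in[3]$, and $Y^{(2)}_j(k,l)=X^{(2)}_{jk}-X^{(2)}_{jl}$ for $j\in[2]$, $1\le k<l\le3$. The payoffs of the game are called generic if all nine numbers $Y^{(1)}_k(1,2)$ and $Y^{(2)}_j(k,l)$ are nonzero and the following three binomials are all nonzero: $$Y^{(2)}_2(1,2)Y^{(2)}_1(1,3)-Y^{(2)}_1(1,2)Y^{(2)}_2(1,3),$$ $$Y^{(2)}_2(1,2)Y^{(2)}_1(2,3)-Y^{(2)}_1(1,2)Y^{(2)}_2(2,3),$$ $$Y^{(2)}_2(1,3)Y^{(2)}_1(2,3)-Y^{(2)}_1(1,3)Y^{(2)}_2(2,3).$$ The face lattice of a polytope is the poset of all its faces ordered by inclusion. Two polytopes have the same combinatorial type (are combinatorially equivalent) if their face lattices are isomorphic. *)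

theory Defs
  imports "HOL-Analysis.Analysis"
begin

text \<open>
  A \<open>(2 \<times> m)\<close>-game is given by payoff matrices \<open>X1 X2 :: real ^ 'm ^ 2\<close> of players 1 and 2,
  where \<open>m = CARD('m)\<close> and \<open>X1 $ j $ k\<close> is the payoff of player 1 when player 1 plays \<open>j\<close> and
  player 2 plays \<open>k\<close>. A joint distribution \<open>p\<close> is a matrix of the same shape.
\<close>

definition correlated_equilibrium_polytope ::
    "real ^ 'm::finite ^ 2 \<Rightarrow> real ^ 'm ^ 2 \<Rightarrow> (real ^ 'm ^ 2) set" where
  "correlated_equilibrium_polytope X1 X2 =
     {p. (\<forall>j k. 0 \<le> p $ j $ k) \<and>
         (\<Sum>j\<in>UNIV. \<Sum>k\<in>UNIV. p $ j $ k) = 1 \<and>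
         (\<forall>j j'. 0 \<le> (\<Sum>k\<in>UNIV. (X1 $ j $ k - X1 $ j' $ k) * p $ j $ k)) \<and>
         (\<forall>k l. 0 \<le> (\<Sum>j\<in>UNIV. (X2 $ j $ k - X2 $ j $ l) * p $ j $ k))}"

definition Y1 :: "real ^ 3 ^ 2 \<Rightarrow> 3 \<Rightarrow> real" where
  "Y1 X1 k = X1 $ 1 $ k - X1 $ 2 $ k"

definition Y2 :: "real ^ 3 ^ 2 \<Rightarrow> 2 \<Rightarrow> 3 \<Rightarrow> 3 \<Rightarrow> real" where
  "Y2 X2 j k l = X2 $ j $ k - X2 $ j $ l"

text \<open>
  The index types \<open>2\<close> and \<open>3\<close> consist of \<open>1, 2\<close> and of \<open>1, 2, 3\<close> (arithmetic is modular, so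
  \<open>3 = 0\<close> in type \<open>3\<close>). The pairs \<open>k < l\<close> are therefore listed explicitly below, rather
  than by means of the order on the type, in which \<open>3\<close> is the least element.
\<close>

definition generic_payoffs :: "real ^ 3 ^ 2 \<Rightarrow> real ^ 3 ^ 2 \<Rightarrow> bool" where
  "generic_payoffs X1 X2 \<longleftrightarrow>
     (\<forall>k. Y1 X1 k \<noteq> 0) \<and>
     (\<forall>j. Y2 X2 j 1 2 \<noteq> 0 \<and> Y2 X2 j 1 3 \<noteq> 0 \<and> Y2 X2 j 2 3 \<noteq> 0) \<and>
     Y2 X2 2 1 2 * Y2 X2 1 1 3 - Y2 X2 1 1 2 * Y2 X2 2 1 3 \<noteq> 0 \<and>
     Y2 X2 2 1 2 * Y2 X2 1 2 3 - Y2 X2 1 1 2 * Y2 X2 2 2 3 \<noteq> 0 \<and>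
     Y2 X2 2 1 3 * Y2 X2 1 2 3 - Y2 X2 1 1 3 * Y2 X2 2 2 3 \<noteq> 0"

text \<open>
  As usual for face lattices, \<open>face_of\<close> counts the empty set and the polytope itself as faces.
\<close>

definition face_lattice :: "'a::real_vector set \<Rightarrow> 'a set set" where
  "face_lattice P = {F. F face_of P}"

definition combinatorially_equivalent ::
    "'a::real_vector set \<Rightarrow> 'b::real_vector set \<Rightarrow> bool" where
  "combinatorially_equivalent P Q \<longleftrightarrow>
     (\<exists>f. bij_betw f (face_lattice P) (face_lattice Q) \<and>
          (\<forall>F\<in>face_lattice P. \<forall>G\<in>face_lattice P. F \<subseteq> G \<longleftrightarrow> f F \<subseteq> f G))"

end

theory Submission
  imports Defs
begin

text \<open>
  A correlated equilibrium \<open>p\<close> attaches to each column \<open>k\<close> a vector \<open>(p $ 1 $ k, p $ 2 $ k)\<close> in the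
  quadrant. The conditions of player 2 say that \<open>k\<close> is a best reply to this vector, and the sets
  of vectors to which the various columns are best replies are sectors that subdivide the quadrant.
  For generic payoffs a sector is trivial or has interior, so one, two or three columns matter; the
  others carry no weight (lemma \<open>ce_region_delete_columns\<close>). Player 1 adds two inequalities, in
  which only the difference \<open>a k\<close> of the payoffs of the two rows in column \<open>k\<close> enters.

  List the nontrivial sectors by increasing slope. If no column with \<open>a > 0\<close> comes before one with
  \<open>a < 0\<close>, the incentives of player 1 push all weight onto the single ray at which the sign of \<open>a\<close>
  changes, and the equilibrium is unique (lemmas \<open>ce_region_point_top_row\<close>,
  \<open>ce_region_point_bottom_row\<close> and \<open>ce_region_point_mixed\<close>). Otherwise there is an equilibrium with
  all inequalities strict. With two sectors the polytope is then that of a game with two columns, of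
  dimension three.

  With three sectors, expanding the vectors in the rays that bound the sectors gives six
  nonnegative coordinates, and the inequalities of player 1 give two more. The eight coordinates
  satisfy two linear relations, so the faces are governed by a Gale diagram of eight vectors in the
  plane, which lie on the four lines spanned by \<open>(1,0)\<close>, \<open>(1,\<sigma>)\<close>, \<open>(1,\<tau>)\<close>, \<open>(0,1)\<close>, two on each. Three
  lines carry a pair of opposite vectors and one carries two vectors of the same direction. Only
  the signs of relations matter for supports, and the sign patterns of relations between four
  directions are those with two changes of sign, whatever \<open>\<sigma>\<close> and \<open>\<tau>\<close> are
  (\<open>alternating_if_balanced\<close>, \<open>balanced_if_alternating\<close>). They are invariant under rotation, so the
  position of the exceptional line is irrelevant too (\<open>octagonal_ce_region\<close>). Hence all these
  polytopes have the same family of supports, and supports determine the face lattice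
  (\<open>combinatorially_equivalent_if_same_supports\<close>).
\<close>

section \<open>Face lattices of slices of polyhedral cones\<close>

text \<open>
  All inequalities are homogeneous and only \<open>h\<close> normalises: a point of the cone may thus be
  rescaled freely before it is placed in the slice.
\<close>

definition cone_slice :: "('a::real_vector \<Rightarrow> real) \<Rightarrow> 'i set \<Rightarrow> ('i \<Rightarrow> 'a \<Rightarrow> real) \<Rightarrow> 'a set" where
  "cone_slice h I f = {x. h x = 1 \<and> (\<forall>i\<in>I. 0 \<le> f i x)}"

definition positive_set :: "'i set \<Rightarrow> ('i \<Rightarrow> 'a \<Rightarrow> real) \<Rightarrow> 'a \<Rightarrow> 'i set" where
  "positive_set I f x = {i \<in> I. 0 < f i x}"

lemma linear_combination:
  assumes "linear (h :: 'a::real_vector \<Rightarrow> real)"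
  shows "h (s *\<^sub>R x + t *\<^sub>R y) = s * h x + t * h y"
  using assms by (simp add: linear_add linear_scale)

lemma convex_cone_slice:
  assumes "linear h" "\<forall>i\<in>I. linear (f i)"
  shows "convex (cone_slice h I f)"
  unfolding convex_def cone_slice_def
  using assms by (auto simp: linear_combination simp flip: distrib_right)

lemma positive_set_open_segment:
  assumes "\<forall>i\<in>I. linear (f i)" "x \<in> cone_slice h I f" "y \<in> cone_slice h I f"
    and "0 < t" "t < 1"
  shows "positive_set I f ((1 - t) *\<^sub>R x + t *\<^sub>R y) = positive_set I f x \<union> positive_set I f y"
proof -
  have "0 < f i ((1 - t) *\<^sub>R x + t *\<^sub>R y) \<longleftrightarrow> 0 < f i x \<or> 0 < f i y" if "i \<in> I" for i
  proof -
    have nn: "0 \<le> f i x" "0 \<le> f i y"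
      using assms that by (auto simp: cone_slice_def)
    have "f i ((1 - t) *\<^sub>R x + t *\<^sub>R y) = (1 - t) * f i x + t * f i y"
      using assms(1) that by (simp add: linear_combination)
    moreover have "0 < (1 - t) * f i x + t * f i y \<longleftrightarrow> 0 < f i x \<or> 0 < f i y"
    proof -
      have "0 \<le> (1 - t) * f i x" "0 \<le> t * f i y" using nn assms by auto
      moreover have "0 < (1 - t) * f i x \<longleftrightarrow> 0 < f i x" "0 < t * f i y \<longleftrightarrow> 0 < f i y"
        using assms by (auto simp: zero_less_mult_iff)
      ultimately show ?thesis by linarith
    qed
    ultimately show ?thesis by simp
  qed
  then show ?thesis by (auto simp: positive_set_def)
qed

text \<open>
  The segment from \<open>y\<close> to \<open>x\<close> can be prolonged beyond \<open>x\<close>: functionals that are positive at \<open>x\<close>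
  leave some room, and those that vanish at \<open>x\<close> vanish at \<open>y\<close>, hence on the whole line.
\<close>

lemma extend_segment_in_cone_slice:
  assumes h: "linear h" and fin: "finite I" and f: "\<forall>i\<in>I. linear (f i)"
    and x: "x \<in> cone_slice h I f" and y: "y \<in> cone_slice h I f"
    and sub: "positive_set I f y \<subseteq> positive_set I f x" and ne: "y \<noteq> x"
  shows "\<exists>z \<in> cone_slice h I f. x \<in> open_segment y z"
proof -
  have "\<exists>e>0. \<forall>i\<in>I. 0 \<le> (1 + e) * f i x - e * f i y"
    using fin f sub x y
  proof (induction I)
    case empty
    then show ?case by (auto intro: exI[of _ 1])
  next
    case (insert j J)
    have "\<exists>e>0. \<forall>i\<in>J. 0 \<le> (1 + e) * f i x - e * f i y"
      using insert by (auto simp: positive_set_def cone_slice_def)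
    then obtain e where e: "e > 0" "\<And>i. i \<in> J \<Longrightarrow> 0 \<le> (1 + e) * f i x - e * f i y" by blast
    have nn: "0 \<le> f i x" "0 \<le> f i y" if "i \<in> insert j J" for i
      using insert.prems that by (auto simp: cone_slice_def)
    have shrink: "0 \<le> (1 + e') * f i x - e' * f i y"
      if "0 < e'" "e' \<le> d" "0 \<le> (1 + d) * f i x - d * f i y" "i \<in> insert j J" for d e' i
    proof -
      have "0 \<le> (e' / d) * ((1 + d) * f i x - d * f i y)" using that by auto
      also have "\<dots> = (e' / d + e') * f i x - e' * f i y"
        using that by (simp add: field_simps)
      also have "\<dots> \<le> (1 + e') * f i x - e' * f i y"
      proof -
        have "(e' / d + e') * f i x \<le> (1 + e') * f i x"
          using nn(1)[OF that(4)] that by (intro mult_right_mono) auto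
        then show ?thesis by simp
      qed
      finally show ?thesis .
    qed
    have "\<exists>d>0. 0 \<le> (1 + d) * f j x - d * f j y"
    proof (cases "0 < f j x")
      case True
      have "0 \<le> (1 + f j x / (1 + f j y)) * f j x - (f j x / (1 + f j y)) * f j y"
        using nn[of j] True by (simp add: field_simps)
      moreover have "f j x / (1 + f j y) > 0" using nn[of j] True by simp
      ultimately show ?thesis by blast
    next
      case False
      then have "f j x = 0" "f j y = 0"
        using nn[of j] insert.prems(2) by (auto simp: positive_set_def)
      then show ?thesis by (auto intro: exI[of _ 1])
    qed
    then obtain d where d: "d > 0" "0 \<le> (1 + d) * f j x - d * f j y" by blast
    have "\<forall>i\<in>insert j J. 0 \<le> (1 + min d e) * f i x - min d e * f i y"
    proof
      fix i assume i: "i \<in> insert j J"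
      show "0 \<le> (1 + min d e) * f i x - min d e * f i y"
      proof (cases "i = j")
        case True
        show ?thesis by (rule shrink[of "min d e" d]) (use d e i True in auto)
      next
        case False
        show ?thesis by (rule shrink[of "min d e" e]) (use d e i False in auto)
      qed
    qed
    then show ?case using d(1) e(1) by (metis min_less_iff_conj)
  qed
  then obtain e where e: "e > 0" "\<And>i. i \<in> I \<Longrightarrow> 0 \<le> (1 + e) * f i x - e * f i y" by blast
  define z where "z = (1 + e) *\<^sub>R x + (- e) *\<^sub>R y"
  have "z \<in> cone_slice h I f"
    using e x y f h by (auto simp: cone_slice_def z_def linear_combination simp del: scaleR_minus_left)
  moreover have "x \<in> open_segment y z"
    unfolding in_segment
  proof (intro conjI exI)
    show "y \<noteq> z"
    proof
      assume "y = z"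
      then have "(1 + e) *\<^sub>R x = (1 + e) *\<^sub>R y"
        by (simp add: z_def algebra_simps)
      then show False using e(1) ne by simp
    qed
    show "0 < 1 / (1 + e)" "1 / (1 + e) < 1" using e(1) by auto
    have "(1 / (1 + e)) *\<^sub>R z = x - (e / (1 + e)) *\<^sub>R y"
      using e(1) by (simp add: z_def scaleR_right_diff_distrib)
    moreover have "1 - 1 / (1 + e) = e / (1 + e)" using e(1) by (simp add: field_simps)
    ultimately show "x = (1 - 1 / (1 + e)) *\<^sub>R y + (1 / (1 + e)) *\<^sub>R z" by simp
  qed
  ultimately show ?thesis by blast
qed

text \<open>
  An inner point of a segment has as support the union of the supports of the two ends. So a subset
  that is closed downwards and under unions of supports is convex and extreme; conversely a face is
  downward closed because segments can be prolonged.
\<close>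

lemma face_of_cone_slice_iff:
  assumes h: "linear h" and fin: "finite I" and f: "\<forall>i\<in>I. linear (f i)"
  shows "F face_of cone_slice h I f \<longleftrightarrow>
    F \<subseteq> cone_slice h I f \<and>
    (\<forall>x\<in>F. \<forall>y\<in>F. \<forall>z\<in>cone_slice h I f.
       positive_set I f z \<subseteq> positive_set I f x \<union> positive_set I f y \<longrightarrow> z \<in> F)"
    (is "_ \<longleftrightarrow> F \<subseteq> ?P \<and> ?ideal")
proof
  let ?pos = "positive_set I f"
  assume face: "F face_of ?P"
  have sub: "F \<subseteq> ?P" using face by (rule face_of_imp_subset)
  have down: "z \<in> F" if xz: "x \<in> F" "z \<in> ?P" "?pos z \<subseteq> ?pos x" for x z
  proof (cases "z = x")
    case False
    have "x \<in> ?P" using sub xz(1) by blast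
    then obtain w where w: "w \<in> ?P" "x \<in> open_segment z w"
      using extend_segment_in_cone_slice[OF h fin f _ xz(2,3)] False by blast
    then show ?thesis using face_ofD[OF face w(2) xz(2) w(1) xz(1)] by blast
  qed (use that in simp)
  have "z \<in> F" if xyz: "x \<in> F" "y \<in> F" "z \<in> ?P" "?pos z \<subseteq> ?pos x \<union> ?pos y" for x y z
  proof (rule down)
    let ?m = "(1 - 1/2) *\<^sub>R x + (1/2::real) *\<^sub>R y"
    show "?m \<in> F"
      by (rule convexD_alt[OF face_of_imp_convex[OF face] xyz(1,2)]) auto
    have P: "x \<in> ?P" "y \<in> ?P" using sub xyz by blast+
    show "?pos z \<subseteq> ?pos ?m"
      using xyz(4) positive_set_open_segment[OF f P, of "1/2"] by simp
  qed (rule xyz(3))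
  then show "F \<subseteq> ?P \<and> ?ideal" using sub by blast
next
  let ?pos = "positive_set I f"
  assume F: "F \<subseteq> ?P \<and> ?ideal"
  then have sub: "F \<subseteq> ?P" by (rule conjunct1)
  have ideal: "z \<in> F" if "x \<in> F" "y \<in> F" "z \<in> ?P" "?pos z \<subseteq> ?pos x \<union> ?pos y" for x y z
    using conjunct2[OF F] that by blast
  have pos: "?pos z = ?pos x \<union> ?pos y" if xyz: "x \<in> ?P" "y \<in> ?P" "z \<in> open_segment x y" for x y z
  proof -
    obtain t where "z = (1 - t) *\<^sub>R x + t *\<^sub>R y" "0 < t" "t < 1"
      using xyz(3) unfolding in_segment by blast
    then show ?thesis using positive_set_open_segment[OF f xyz(1,2)] by simp
  qed
  show "F face_of ?P"
    unfolding face_of_def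
  proof (intro conjI ballI impI)
    show "F \<subseteq> ?P" by (rule sub)
    show "convex F"
      unfolding convex_contains_open_segment
    proof (intro ballI subsetI)
      fix x y z assume xyz: "x \<in> F" "y \<in> F" "z \<in> open_segment x y"
      then have P: "x \<in> ?P" "y \<in> ?P" using sub by blast+
      then have "z \<in> ?P"
        using convex_cone_slice[OF h f] xyz(3) unfolding convex_contains_open_segment by blast
      then show "z \<in> F" using ideal[OF xyz(1,2)] pos[OF P xyz(3)] by simp
    qed
    fix x y z assume P: "x \<in> ?P" "y \<in> ?P" and z: "z \<in> F" "z \<in> open_segment x y"
    show "x \<in> F" "y \<in> F"
      using ideal[OF z(1) z(1)] P pos[OF P z(2)] by simp_all
  qed
qed

text \<open>
  By the previous lemma a face is determined by the ideal formed by its supports, so the family of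
  all supports already determines the face lattice.
\<close>

theorem combinatorially_equivalent_if_same_supports:
  fixes h :: "'a::real_vector \<Rightarrow> real" and h' :: "'b::real_vector \<Rightarrow> real"
  assumes fin: "finite I"
    and h: "linear h" and f: "\<forall>i\<in>I. linear (f i)"
    and h': "linear h'" and g: "\<forall>i\<in>I. linear (g i)"
    and eq: "positive_set I f ` cone_slice h I f = positive_set I g ` cone_slice h' I g"
  shows "combinatorially_equivalent (cone_slice h I f) (cone_slice h' I g)"
proof -
  define P where "P = cone_slice h I f"
  define Q where "Q = cone_slice h' I g"
  let ?f = "positive_set I f" and ?g = "positive_set I g"
  define fwd where "fwd F = {y \<in> Q. \<exists>x\<in>F. ?g y = ?f x}" for F
  define bwd where "bwd G = {x \<in> P. \<exists>y\<in>G. ?f x = ?g y}" for G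
  note faceP = face_of_cone_slice_iff[OF h fin f, folded P_def]
  note faceQ = face_of_cone_slice_iff[OF h' fin g, folded Q_def]
  have exQ: "\<exists>y\<in>Q. ?g y = ?f x" if "x \<in> P" for x
  proof -
    have "?f x \<in> ?g ` Q" using that eq unfolding P_def Q_def by blast
    then show ?thesis by (metis imageE)
  qed
  have exP: "\<exists>x\<in>P. ?f x = ?g y" if "y \<in> Q" for y
  proof -
    have "?g y \<in> ?f ` P" using that eq unfolding P_def Q_def by blast
    then show ?thesis by (metis imageE)
  qed
  have fwd_face: "fwd F face_of Q" if F: "F face_of P" for F
    unfolding faceQ
  proof (intro conjI ballI impI)
    fix x y z assume xyz: "x \<in> fwd F" "y \<in> fwd F" "z \<in> Q" "?g z \<subseteq> ?g x \<union> ?g y"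
    obtain x' where x': "x' \<in> F" "?g x = ?f x'" using xyz(1) unfolding fwd_def by blast
    obtain y' where y': "y' \<in> F" "?g y = ?f y'" using xyz(2) unfolding fwd_def by blast
    obtain z' where z': "z' \<in> P" "?f z' = ?g z" using xyz(3) exP by blast
    have "?f z' \<subseteq> ?f x' \<union> ?f y'" using xyz(4) x'(2) y'(2) z'(2) by simp
    then have "z' \<in> F" using F x'(1) y'(1) z'(1) unfolding faceP by blast
    then show "z \<in> fwd F"
      using z'(2)[symmetric] xyz(3) unfolding fwd_def by blast
  qed (auto simp: fwd_def)
  have bwd_face: "bwd G face_of P" if G: "G face_of Q" for G
    unfolding faceP
  proof (intro conjI ballI impI)
    fix x y z assume xyz: "x \<in> bwd G" "y \<in> bwd G" "z \<in> P" "?f z \<subseteq> ?f x \<union> ?f y"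
    obtain x' where x': "x' \<in> G" "?f x = ?g x'" using xyz(1) unfolding bwd_def by blast
    obtain y' where y': "y' \<in> G" "?f y = ?g y'" using xyz(2) unfolding bwd_def by blast
    obtain z' where z': "z' \<in> Q" "?g z' = ?f z" using xyz(3) exQ by blast
    have "?g z' \<subseteq> ?g x' \<union> ?g y'" using xyz(4) x'(2) y'(2) z'(2) by simp
    then have "z' \<in> G" using G x'(1) y'(1) z'(1) unfolding faceQ by blast
    then show "z \<in> bwd G"
      using z'(2)[symmetric] xyz(3) unfolding bwd_def by blast
  qed (auto simp: bwd_def)
  have bwd_fwd: "bwd (fwd F) = F" if F: "F face_of P" for F
  proof (intro equalityI subsetI)
    fix x assume "x \<in> bwd (fwd F)"
    then obtain y x' where "x \<in> P" "?f x = ?g y" "x' \<in> F" "?g y = ?f x'"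
      unfolding fwd_def bwd_def by blast
    then have "?f x \<subseteq> ?f x' \<union> ?f x'" by simp
    then show "x \<in> F" using F \<open>x \<in> P\<close> \<open>x' \<in> F\<close> unfolding faceP by blast
  next
    fix x assume x: "x \<in> F"
    then have "x \<in> P" using F unfolding faceP by blast
    then obtain y where "y \<in> Q" "?g y = ?f x" using exQ by blast
    moreover from this have "y \<in> fwd F" using x unfolding fwd_def by blast
    ultimately show "x \<in> bwd (fwd F)" using \<open>x \<in> P\<close> unfolding bwd_def by force
  qed
  have fwd_bwd: "fwd (bwd G) = G" if G: "G face_of Q" for G
  proof (intro equalityI subsetI)
    fix y assume "y \<in> fwd (bwd G)"
    then obtain x y' where "y \<in> Q" "?g y = ?f x" "y' \<in> G" "?f x = ?g y'"
      unfolding fwd_def bwd_def by blast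
    then have "?g y \<subseteq> ?g y' \<union> ?g y'" by simp
    then show "y \<in> G" using G \<open>y \<in> Q\<close> \<open>y' \<in> G\<close> unfolding faceQ by blast
  next
    fix y assume y: "y \<in> G"
    then have "y \<in> Q" using G unfolding faceQ by blast
    then obtain x where "x \<in> P" "?f x = ?g y" using exP by blast
    moreover from this have "x \<in> bwd G" using y unfolding bwd_def by blast
    ultimately show "y \<in> fwd (bwd G)" using \<open>y \<in> Q\<close> unfolding fwd_def by force
  qed
  have "bij_betw fwd (face_lattice P) (face_lattice Q)"
    unfolding face_lattice_def
  proof (rule bij_betw_byWitness[where f' = bwd])
    show "\<forall>F\<in>{F. F face_of P}. bwd (fwd F) = F" using bwd_fwd by blast
    show "\<forall>G\<in>{G. G face_of Q}. fwd (bwd G) = G" using fwd_bwd by blast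
    show "fwd ` {F. F face_of P} \<subseteq> {G. G face_of Q}" using fwd_face by blast
    show "bwd ` {G. G face_of Q} \<subseteq> {F. F face_of P}" using bwd_face by blast
  qed
  moreover have "F \<subseteq> G \<longleftrightarrow> fwd F \<subseteq> fwd G" if "F face_of P" "G face_of P" for F G
  proof
    show "fwd F \<subseteq> fwd G" if "F \<subseteq> G" using that unfolding fwd_def by blast
    assume "fwd F \<subseteq> fwd G"
    then have "bwd (fwd F) \<subseteq> bwd (fwd G)" unfolding bwd_def by blast
    then show "F \<subseteq> G" using bwd_fwd that by simp
  qed
  ultimately show ?thesis
    unfolding combinatorially_equivalent_def P_def[symmetric] Q_def[symmetric] face_lattice_def
    by blast
qed

lemma combinatorially_equivalent_linear_image:
  assumes "linear g" "inj g"
  shows "combinatorially_equivalent P (g ` P)"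
proof -
  have "bij_betw ((`) g) (face_lattice P) (face_lattice (g ` P))"
    unfolding bij_betw_def face_lattice_def
  proof
    show "inj_on ((`) g) {F. F face_of P}"
      using assms(2) by (auto simp: inj_on_def inj_image_eq_iff)
    show "(`) g ` {F. F face_of P} = {F. F face_of g ` P}"
    proof (intro equalityI subsetI)
      fix G assume "G \<in> {F. F face_of g ` P}"
      moreover from this obtain F where "G = g ` F"
        by (metis face_of_imp_subset mem_Collect_eq subset_imageE)
      ultimately show "G \<in> (`) g ` {F. F face_of P}"
        using face_of_linear_image[OF assms, of F P] by blast
    next
      fix G assume "G \<in> (`) g ` {F. F face_of P}"
      then obtain F where "G = g ` F" "F face_of P" by blast
      then show "G \<in> {F. F face_of g ` P}"
        using face_of_linear_image[OF assms, of F P] by simp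
    qed
  qed
  moreover have "F \<subseteq> G \<longleftrightarrow> g ` F \<subseteq> g ` G" for F G
    using assms(2) by (simp add: inj_image_subset_iff)
  ultimately show ?thesis unfolding combinatorially_equivalent_def by blast
qed

text \<open>
  Near a point at which all functionals are positive, the slice agrees with the hyperplane \<open>h = 1\<close>.
\<close>

lemma aff_dim_cone_slice:
  fixes h :: "'a::euclidean_space \<Rightarrow> real"
  assumes h: "linear h" and fin: "finite I" and f: "\<forall>i\<in>I. linear (f i)"
    and x: "0 < h x" "\<And>i. i \<in> I \<Longrightarrow> 0 < f i x"
  shows "aff_dim (cone_slice h I f) = int DIM('a) - 1"
proof -
  define a where "a = adjoint h 1"
  have ha: "h y = a \<bullet> y" for y
    using adjoint_works[OF h, of y 1] by (simp add: a_def inner_commute)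
  let ?H = "{y. a \<bullet> y = 1}" and ?U = "{y. \<forall>i\<in>I. 0 < f i y}"
  have "a \<noteq> 0" using x(1) ha by auto
  then have H: "aff_dim ?H = int DIM('a) - 1" by (simp add: of_nat_diff)
  have "open ?U"
  proof -
    have "?U = (\<Inter>i\<in>I. {y. 0 < f i y})" by auto
    moreover have "open (\<Inter>i\<in>I. {y. 0 < f i y})"
    proof (intro open_INT fin ballI open_Collect_less continuous_on_const)
      show "continuous_on UNIV (f i)" if "i \<in> I" for i
        using bspec[OF f that] by (rule linear_continuous_on[OF linear_conv_bounded_linear[THEN iffD1]])
    qed
    ultimately show ?thesis by simp
  qed
  moreover have "?H \<inter> ?U \<noteq> {}"
  proof -
    have "h ((1 / h x) *\<^sub>R x) = 1" using x(1) linear_scale[OF h, of "1 / h x" x] by simp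
    moreover have "0 < f i ((1 / h x) *\<^sub>R x)" if "i \<in> I" for i
      using x linear_scale[OF bspec[OF f that], of "1 / h x" x] that by simp
    ultimately have "(1 / h x) *\<^sub>R x \<in> ?H \<inter> ?U" using ha by simp
    then show ?thesis by blast
  qed
  ultimately have "aff_dim (?H \<inter> ?U) = aff_dim ?H"
    using aff_dim_convex_Int_open[of ?H ?U] by (auto simp: convex_hyperplane)
  moreover have "?H \<inter> ?U \<subseteq> cone_slice h I f" "cone_slice h I f \<subseteq> ?H"
    by (auto simp: cone_slice_def ha less_imp_le)
  then have "aff_dim (?H \<inter> ?U) \<le> aff_dim (cone_slice h I f)" "aff_dim (cone_slice h I f) \<le> aff_dim ?H"
    by (auto intro!: aff_dim_subset)
  ultimately show ?thesis using H by simp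
qed

lemma polyhedron_cone_slice:
  fixes h :: "'a::euclidean_space \<Rightarrow> real"
  assumes h: "linear h" and fin: "finite I" and f: "\<forall>i\<in>I. linear (f i)"
  shows "polyhedron (cone_slice h I f)"
proof -
  have inner: "g x = adjoint g 1 \<bullet> x" if "linear g" for g :: "'a \<Rightarrow> real" and x
    using adjoint_works[OF that, of x 1] by (simp add: inner_commute)
  have "polyhedron {x. h x = 1}"
    using polyhedron_hyperplane[of "adjoint h 1" 1] by (simp add: inner[OF h, symmetric])
  moreover have "polyhedron {x. 0 \<le> f i x}" if "i \<in> I" for i
    using polyhedron_halfspace_ge[of 0 "adjoint (f i) 1"]
    by (simp add: inner[OF bspec[OF f that], symmetric])
  then have "polyhedron (\<Inter>i\<in>I. {x. 0 \<le> f i x})"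
    using fin by (intro polyhedron_Inter) auto
  moreover have "cone_slice h I f = {x. h x = 1} \<inter> (\<Inter>i\<in>I. {x. 0 \<le> f i x})"
    by (auto simp: cone_slice_def)
  ultimately show ?thesis by (simp add: polyhedron_Int)
qed

section \<open>Sign vectors with two changes of sign\<close>

text \<open>
  Either everything vanishes or the sequence has at least two changes of sign (zeros are skipped).
  For \<open>0 < \<sigma> < \<tau>\<close> these are the sign patterns of the linear relations
  \<open>c0 (1,0) + c1 (1,\<sigma>) + c2 (1,\<tau>) + c3 (0,1) = 0\<close> between four plane vectors listed
  by increasing angle; the two lemmas on balanced sequences below prove this. The point is that
  \<open>\<sigma>\<close> and \<open>\<tau>\<close> do not occur in the description.
\<close>

definition alternating :: "real \<Rightarrow> real \<Rightarrow> real \<Rightarrow> real \<Rightarrow> bool" where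
  "alternating c0 c1 c2 c3 \<longleftrightarrow>
     c0 = 0 \<and> c1 = 0 \<and> c2 = 0 \<and> c3 = 0 \<or>
     c0 * c1 < 0 \<and> c1 * c2 < 0 \<or> c0 * c1 < 0 \<and> c1 * c3 < 0 \<or>
     c0 * c2 < 0 \<and> c2 * c3 < 0 \<or> c1 * c2 < 0 \<and> c2 * c3 < 0"

lemma alternating_uminus:
  "alternating (- c0) (- c1) (- c2) (- c3) \<longleftrightarrow> alternating c0 c1 c2 c3"
  by (simp add: alternating_def)

text \<open>
  Turning past one vector replaces the four directions \<open>d0, d1, d2, d3\<close> by \<open>d1, d2, d3, - d0\<close>,
  which again come in the order of their angles.
\<close>

lemma alternating_rotate: "alternating c1 c2 c3 (- c0) \<longleftrightarrow> alternating c0 c1 c2 c3"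
  unfolding alternating_def mult_less_0_iff by (smt (verit))

lemma alternating_if_balanced:
  assumes "0 < \<sigma>" "\<sigma> < \<tau>"
    and "c0 + c1 + c2 = 0" "\<sigma> * c1 + \<tau> * c2 + c3 = 0"
  shows "alternating c0 c1 c2 c3"
proof -
  have *: "alternating c0 c1 c2 c3"
    if c: "0 \<le> c1" "c0 + c1 + c2 = 0" "\<sigma> * c1 + \<tau> * c2 + c3 = 0" for c0 c1 c2 c3
  proof -
    have c0: "c0 = - (c1 + c2)" and c3: "c3 = - (\<sigma> * c1 + \<tau> * c2)" using c by auto
    consider "c1 = 0" "c2 = 0" | "c1 = 0" "c2 > 0" | "c1 = 0" "c2 < 0" | "c1 > 0" "c2 = 0" | "c1 > 0" "c2 > 0"
      | "c1 > 0" "c2 < 0" using c(1) by linarith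
    then show ?thesis
    proof cases
      case 5
      then have "0 < \<sigma> * c1" "0 < \<tau> * c2" using assms by auto
      then show ?thesis using 5 c0 c3 by (auto simp: alternating_def mult_less_0_iff)
    next
      case 6
      \<comment> \<open>if both signs were wrong then \<open>\<tau> \<bar>c2\<bar> \<le> \<sigma> c1 \<le> \<sigma> \<bar>c2\<bar>\<close>\<close>
      have "c0 < 0 \<or> c3 > 0"
      proof (rule ccontr)
        assume "\<not> ?thesis"
        then have "c1 \<le> - c2" "- (\<tau> * c2) \<le> \<sigma> * c1" using c0 c3 by auto
        moreover have "\<sigma> * c1 \<le> \<sigma> * (- c2)" using assms \<open>c1 \<le> - c2\<close> by (intro mult_left_mono) auto
        moreover have "\<sigma> * (- c2) < \<tau> * (- c2)" using assms 6 by (intro mult_strict_right_mono) auto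
        ultimately show False by simp
      qed
      then show ?thesis using 6 by (auto simp: alternating_def mult_less_0_iff)
    qed (use assms c0 c3 in \<open>auto simp: alternating_def mult_less_0_iff zero_less_mult_iff\<close>)
  qed
  show ?thesis
  proof (cases "0 \<le> c1")
    case True
    then show ?thesis using * assms by blast
  next
    case False
    then have "alternating (- c0) (- c1) (- c2) (- c3)"
      using assms(3,4) by (intro *) (auto simp: algebra_simps)
    then show ?thesis by (simp add: alternating_uminus)
  qed
qed

text \<open>
  Converse up to positive rescaling of the entries, which is enough for statements about supports.
  A relation is fixed by \<open>c1\<close> and \<open>c2\<close>, so it suffices to find values of these two that give all
  four entries the prescribed signs.
\<close>

lemma balanced_if_alternating:
  assumes st: "0 < \<sigma>" "\<sigma> < \<tau>" and "alternating c0 c1 c2 c3"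
  obtains l0 l1 l2 l3 where "0 < l0" "0 < l1" "0 < l2" "0 < l3"
    "l0 * c0 + l1 * c1 + l2 * c2 = 0" "\<sigma> * (l1 * c1) + \<tau> * (l2 * c2) + l3 * c3 = (0::real)"
proof -
  have *: "\<exists>d1 d2. sgn d1 = sgn c1 \<and> sgn d2 = sgn c2 \<and> sgn (- (d1 + d2)) = sgn c0 \<and>
      sgn (- (\<sigma> * d1 + \<tau> * d2)) = sgn c3"
    if alt: "alternating c0 c1 c2 c3" and c1: "0 \<le> c1" for c0 c1 c2 c3
  proof -
    consider "c1 = 0" | "c1 > 0" "c2 \<ge> 0" | "c1 > 0" "c2 < 0" using c1 by linarith
    then show ?thesis
    proof cases
      case 1
      have "sgn c0 = - sgn c2" "sgn c3 = - sgn c2"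
        using alt 1 by (auto simp: alternating_def mult_less_0_iff)
      then show ?thesis
        using 1 st by - (rule exI[of _ 0], rule exI[of _ c2], auto simp: sgn_mult sgn_minus)
    next
      case 2
      then have "c0 < 0" "c3 < 0"
        using alt by (auto simp: alternating_def mult_less_0_iff)
      moreover have "0 < \<sigma> * c1" "0 \<le> \<tau> * c2" using 2 st by auto
      ultimately show ?thesis
        using 2 by - (rule exI[of _ c1], rule exI[of _ c2], auto)
    next
      case 3
      have t: "1 < \<tau> / \<sigma>" using st by simp
      \<comment> \<open>With \<open>c2 = - 1\<close> and \<open>c1 = p\<close> the signs of \<open>c0\<close> and \<open>c3\<close> record the position of \<open>p\<close>
        relative to \<open>1\<close> and to \<open>\<tau> / \<sigma>\<close>. As \<open>1 < \<tau> / \<sigma>\<close>, only \<open>p \<le> 1\<close> together with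
        \<open>\<tau> / \<sigma> \<le> p\<close> is impossible, and that pair of signs is not alternating.\<close>
      have "\<exists>p>0. sgn (1 - p) = sgn c0 \<and> sgn (r - p) = sgn c3" if r: "1 < r" for r
      proof -
        consider "c0 \<ge> 0" "c3 > 0" | "c0 < 0" "c3 > 0" | "c0 < 0" "c3 = 0" | "c0 < 0" "c3 < 0"
        proof -
          have "c0 < 0 \<or> 0 < c3" using alt 3 by (auto simp: alternating_def mult_less_0_iff)
          then show thesis using that by linarith
        qed
        then show ?thesis
        proof cases
          case 1
          then show ?thesis using r by (intro exI[of _ "if c0 = 0 then 1 else 1/2"]) (auto simp: sgn_if)
        next
          case 2
          then show ?thesis using r by (intro exI[of _ "(1 + r) / 2"]) (auto simp: sgn_if)
        next
          case 3
          then show ?thesis using r by (intro exI[of _ r]) (auto simp: sgn_if)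
        next
          case 4
          then show ?thesis using r by (intro exI[of _ "2 * r"]) (auto simp: sgn_if)
        qed
      qed
      note this[OF t]
      then obtain p where p: "p > 0" "sgn (1 - p) = sgn c0" "sgn (\<tau> / \<sigma> - p) = sgn c3" by blast
      have "- (\<sigma> * p + \<tau> * (- 1)) = \<sigma> * (\<tau> / \<sigma> - p)" using st by (simp add: field_simps)
      then have "sgn (- (\<sigma> * p + \<tau> * (- 1))) = sgn c3" using p(3) st by (simp only: sgn_mult) simp
      then show ?thesis using 3 p by - (rule exI[of _ p], rule exI[of _ "-1"], auto)
    qed
  qed
  have "\<exists>d1 d2. sgn d1 = sgn c1 \<and> sgn d2 = sgn c2 \<and> sgn (- (d1 + d2)) = sgn c0 \<and>
      sgn (- (\<sigma> * d1 + \<tau> * d2)) = sgn c3"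
  proof (cases "0 \<le> c1")
    case True
    then show ?thesis using * assms by blast
  next
    case False
    then obtain d1 d2 where "sgn d1 = sgn (- c1)" "sgn d2 = sgn (- c2)" "sgn (- (d1 + d2)) = sgn (- c0)"
        "sgn (- (\<sigma> * d1 + \<tau> * d2)) = sgn (- c3)"
      using *[of "- c0" "- c1" "- c2" "- c3"] assms(3) by (auto simp: alternating_uminus)
    moreover have "- (- d1 + - d2) = d1 + d2"
      "- (\<sigma> * (- d1) + \<tau> * (- d2)) = \<sigma> * d1 + \<tau> * d2" by simp_all
    ultimately have "sgn (- d1) = sgn c1" "sgn (- d2) = sgn c2" "sgn (- (- d1 + - d2)) = sgn c0"
        "sgn (- (\<sigma> * (- d1) + \<tau> * (- d2))) = sgn c3"
      by (simp_all only: sgn_minus)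
    then show ?thesis by blast
  qed
  then obtain d1 d2 where d: "sgn d1 = sgn c1" "sgn d2 = sgn c2" "sgn (- (d1 + d2)) = sgn c0"
      "sgn (- (\<sigma> * d1 + \<tau> * d2)) = sgn c3" by blast
  have ex: "\<exists>l>0. l * c = d" if "sgn d = sgn c" for c d :: real
  proof (cases "c = 0")
    case False
    then have "0 < d / c" using that by (auto simp: sgn_if zero_less_divide_iff split: if_splits)
    then show ?thesis using False by (intro exI[of _ "d / c"]) simp
  next
    case True
    then have "d = 0" using that by (simp add: sgn_eq_0_iff)
    then show ?thesis using True by (intro exI[of _ 1]) simp
  qed
  obtain l0 l1 l2 l3 where "l0 > 0" "l0 * c0 = - (d1 + d2)" "l1 > 0" "l1 * c1 = d1"
      "l2 > 0" "l2 * c2 = d2" "l3 > 0" "l3 * c3 = - (\<sigma> * d1 + \<tau> * d2)"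
    using ex[OF d(1)] ex[OF d(2)] ex[OF d(3)] ex[OF d(4)] by blast
  then show thesis using that[of l0 l1 l2 l3] by simp
qed

section \<open>Correlated equilibria in terms of payoff differences\<close>

definition total :: "real ^ 'm::finite ^ 2 \<Rightarrow> real" where
  "total p = (\<Sum>k\<in>UNIV. p $ 1 $ k + p $ 2 $ k)"

text \<open>
  Here \<open>a k\<close> is the gain of player 1 from row 1 over row 2 in column \<open>k\<close>, and \<open>b\<close>, \<open>c\<close> are the two rows
  of payoffs of player 2. The last condition says that column \<open>k\<close> is a best reply of player 2 to
  the unnormalised mixed strategy \<open>(p $ 1 $ k, p $ 2 $ k)\<close>, so it confines this pair to a sector of
  the quadrant that depends only on \<open>b\<close>, \<open>c\<close> and \<open>k\<close>.
\<close>

definition ce_region :: "('m::finite \<Rightarrow> real) \<Rightarrow> ('m \<Rightarrow> real) \<Rightarrow> ('m \<Rightarrow> real) \<Rightarrow> (real ^ 'm ^ 2) set" where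
  "ce_region a b c = {p. total p = 1 \<and>
     (\<forall>k. 0 \<le> p $ 1 $ k \<and> 0 \<le> p $ 2 $ k) \<and>
     0 \<le> (\<Sum>k\<in>UNIV. a k * p $ 1 $ k) \<and> (\<Sum>k\<in>UNIV. a k * p $ 2 $ k) \<le> 0 \<and>
     (\<forall>k l. 0 \<le> (b k - b l) * p $ 1 $ k + (c k - c l) * p $ 2 $ k)}"

lemma correlated_equilibrium_polytope_eq_ce_region:
  "correlated_equilibrium_polytope X1 X2 =
     ce_region (\<lambda>k. X1 $ 1 $ k - X1 $ 2 $ k) (($) (X2 $ 1)) (($) (X2 $ 2))"
proof -
  have "(\<Sum>k\<in>UNIV. (X1 $ 2 $ k - X1 $ 1 $ k) * p $ 2 $ k) =
      - (\<Sum>k\<in>UNIV. (X1 $ 1 $ k - X1 $ 2 $ k) * p $ 2 $ k)" for p :: "real ^ 'a ^ 2"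
    by (simp flip: sum_negf) (simp add: algebra_simps)
  then show ?thesis
    unfolding correlated_equilibrium_polytope_def ce_region_def total_def
    by (auto simp: forall_2 sum_2 sum.distrib)
qed

lemma linear_total: "linear total"
  unfolding total_def
  by (rule linearI) (simp_all add: sum.distrib sum_distrib_left algebra_simps)

text \<open>
  Exchanging the strategies of player 1 is a symmetry of the setting, up to the sign of \<open>a\<close>.
\<close>

definition swap_rows :: "real ^ 'm::finite ^ 2 \<Rightarrow> real ^ 'm ^ 2" where
  "swap_rows p = (\<chi> j. if j = 1 then p $ 2 else p $ 1)"

lemma ce_region_swap_rows:
  "ce_region a b c = swap_rows ` ce_region (\<lambda>k. - a k) c b"
proof -
  have sub: "swap_rows ` ce_region (\<lambda>k. - a k) c b \<subseteq> ce_region a b c" for a b c :: "'a::finite \<Rightarrow> real"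
    by (auto simp: ce_region_def swap_rows_def total_def sum_negf add.commute)
  have inv: "swap_rows (swap_rows p) = p" for p :: "real ^ 'a ^ 2"
    by (simp add: swap_rows_def vec_eq_iff forall_2)
  have "swap_rows ` ce_region a b c \<subseteq> ce_region (\<lambda>k. - a k) c b"
    using sub[of "\<lambda>k. - a k" b c] by simp
  then have "p \<in> swap_rows ` ce_region (\<lambda>k. - a k) c b" if "p \<in> ce_region a b c" for p
    using that by (metis image_subset_iff inv rev_image_eqI)
  then show ?thesis using sub by blast
qed

section \<open>Games with a single correlated equilibrium\<close>

text \<open>
  If row 1 is strictly better in every column that can carry weight, row 2 has no weight, and all
  weight lies on the unique best reply to row 1.
\<close>

lemma ce_region_point_top_row:
  assumes b: "\<And>l. l \<noteq> k \<Longrightarrow> b l < b k" and ak: "0 < a k"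
    and a: "\<And>p l. p \<in> ce_region a b c \<Longrightarrow> 0 < a l \<or> p $ 1 $ l = 0 \<and> p $ 2 $ l = 0"
  shows "\<exists>p. ce_region a b c = {p}"
proof -
  define q :: "real ^ 'a ^ 2" where "q = (\<chi> j l. if j = 1 \<and> l = k then 1 else 0)"
  have q: "q $ 1 $ l = (if l = k then 1 else 0)" "q $ 2 $ l = 0" for l
    by (simp_all add: q_def)
  have "q \<in> ce_region a b c"
    using b ak by (auto simp: ce_region_def total_def q if_distrib[of "(*) _"] cong: if_cong)
      (metis less_imp_le order_refl)
  moreover have "p = q" if p: "p \<in> ce_region a b c" for p
  proof -
    have nn: "0 \<le> a l * p $ 2 $ l" for l
      using p a[OF p, of l] by (auto simp: ce_region_def)
    moreover have "(\<Sum>l\<in>UNIV. a l * p $ 2 $ l) \<le> 0" using p by (simp add: ce_region_def)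
    ultimately have "(\<Sum>l\<in>UNIV. a l * p $ 2 $ l) = 0"
      by (intro order_antisym sum_nonneg) auto
    then have "a l * p $ 2 $ l = 0" for l using nn by (simp add: sum_nonneg_eq_0_iff)
    then have y: "p $ 2 $ l = 0" for l using a[OF p, of l] by (metis less_irrefl mult_eq_0_iff)
    have x: "p $ 1 $ l = 0" if "l \<noteq> k" for l
    proof -
      have "0 \<le> (b l - b k) * p $ 1 $ l" "0 \<le> p $ 1 $ l"
        using p y[of l] by (auto simp: ce_region_def dest: spec2[of _ l k])
      then show ?thesis using b[OF that] by (auto simp: zero_le_mult_iff)
    qed
    have "total p = (\<Sum>l\<in>UNIV. if l = k then p $ 1 $ k else 0)"
      unfolding total_def using x y by (intro sum.cong) auto
    then have "p $ 1 $ k = 1" using p by (simp add: ce_region_def)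
    then show ?thesis using x y by (auto simp: vec_eq_iff forall_2 q)
  qed
  ultimately show ?thesis by blast
qed

lemma ce_region_point_bottom_row:
  assumes c: "\<And>l. l \<noteq> k \<Longrightarrow> c l < c k" and ak: "a k < 0"
    and a: "\<And>p l. p \<in> ce_region a b c \<Longrightarrow> a l < 0 \<or> p $ 1 $ l = 0 \<and> p $ 2 $ l = 0"
  shows "\<exists>p. ce_region a b c = {p}"
proof -
  have "\<exists>p. ce_region (\<lambda>k. - a k) c b = {p}"
  proof (rule ce_region_point_top_row)
    fix p l assume "p \<in> ce_region (\<lambda>k. - a k) c b"
    then have "swap_rows p \<in> ce_region a b c" using ce_region_swap_rows by blast
    from a[OF this, of l] show "0 < - a l \<or> p $ 1 $ l = 0 \<and> p $ 2 $ l = 0"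
      by (auto simp: swap_rows_def)
  qed (use c ak in auto)
  then show ?thesis using ce_region_swap_rows[of a b c] by auto
qed

lemma UNIV_3_eq:
  fixes k l m :: 3
  assumes "k \<noteq> l" "k \<noteq> m" "l \<noteq> m"
  shows "UNIV = {k, l, m}"
  by (rule card_subset_eq[symmetric]) (use assms in auto)

lemma sum_UNIV_3:
  fixes k l m :: 3 and f :: "3 \<Rightarrow> real"
  assumes "k \<noteq> l" "k \<noteq> m" "l \<noteq> m"
  shows "sum f UNIV = f k + f l + f m"
  unfolding UNIV_3_eq[OF assms] using assms by (simp add: add.assoc)

lemma all_UNIV_3:
  fixes k l m :: 3
  assumes "k \<noteq> l" "k \<noteq> m" "l \<noteq> m"
  shows "(\<forall>i. P i) \<longleftrightarrow> P k \<and> P l \<and> P m"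
  using UNIV_3_eq[OF assms] by (metis UNIV_I empty_iff insert_iff)

text \<open>
  Columns \<open>k\<close> and \<open>l\<close> are equally good against the direction \<open>(1, \<rho>)\<close> and column \<open>m\<close> is worse. Player 1
  prefers row 2 in the columns whose sector lies below this ray and row 1 in those above it, so
  \<open>a i * (y i - \<rho> * x i) \<ge> 0\<close> for the weights \<open>(x i, y i)\<close> of each column \<open>i\<close>; but the conditions of
  player 1 force the sum of these terms to be \<open>\<le> 0\<close>. Hence all weight lies on the ray, and the
  indifference of player 1 fixes how it is shared between \<open>k\<close> and \<open>l\<close>.
\<close>

lemma ce_region_point_mixed:
  fixes a b c :: "3 \<Rightarrow> real"
  assumes d: "k \<noteq> l" "k \<noteq> m" "l \<noteq> m"
    and a: "a k < 0" "0 < a l" "a m \<noteq> 0"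
    and c: "c k < c l" and \<rho>: "0 < \<rho>" "b k - b l = \<rho> * (c l - c k)"
    and m: "b m + \<rho> * c m < b k + \<rho> * c k"
    and m_neg: "a m < 0 \<Longrightarrow> c m < c l" and m_pos: "0 < a m \<Longrightarrow> b m < b k"
  shows "\<exists>p. ce_region a b c = {p}"
proof -
  note sum3 = sum_UNIV_3[OF d] and all3 = all_UNIV_3[OF d]
  \<comment> \<open>the shares that make player 1 indifferent and have total weight \<open>1\<close>\<close>
  define X where "X = a l / ((a l - a k) * (1 + \<rho>))"
  define Y where "Y = - a k / ((a l - a k) * (1 + \<rho>))"
  have XY: "0 < X" "0 < Y" using a \<rho> by (auto simp: X_def Y_def divide_simps mult_less_0_iff)
  have XYsum: "(1 + \<rho>) * (X + Y) = 1"
  proof -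
    have "X + Y = (a l - a k) / ((a l - a k) * (1 + \<rho>))" by (simp add: X_def Y_def diff_divide_distrib)
    then show ?thesis using a \<rho> by simp
  qed
  have XYbal: "a k * X + a l * Y = 0" by (simp add: X_def Y_def)
  define q :: "real ^ 3 ^ 2" where
    "q = (\<chi> j i. (if j = 1 then 1 else \<rho>) * (if i = k then X else if i = l then Y else 0))"
  have q: "q $ 1 $ k = X" "q $ 1 $ l = Y" "q $ 1 $ m = 0" "q $ 2 $ k = \<rho> * X" "q $ 2 $ l = \<rho> * Y" "q $ 2 $ m = 0"
    using d by (auto simp: q_def)
  have ml: "b m + \<rho> * c m < b l + \<rho> * c l" using m \<rho> by (simp add: algebra_simps)
  have "q \<in> ce_region a b c"
  proof -
    have br: "0 \<le> (b i - b j) * z + (c i - c j) * (\<rho> * z)"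
      if "b j + \<rho> * c j \<le> b i + \<rho> * c i" "0 \<le> z" for i j z
    proof -
      have "(b i - b j) * z + (c i - c j) * (\<rho> * z) = ((b i + \<rho> * c i) - (b j + \<rho> * c j)) * z"
        by (simp add: algebra_simps)
      also have "0 \<le> \<dots>" using that by (intro mult_nonneg_nonneg) auto
      finally show ?thesis .
    qed
    have eq: "b k + \<rho> * c k = b l + \<rho> * c l" using \<rho> by (simp add: algebra_simps)
    have "total q = 1" using XYsum by (simp add: total_def sum3 q algebra_simps)
    moreover have "a k * (\<rho> * X) + a l * (\<rho> * Y) = \<rho> * (a k * X + a l * Y)" by (simp add: algebra_simps)
    ultimately show ?thesis
      using XY \<rho>(1) XYbal m ml eq
      unfolding ce_region_def mem_Collect_eq sum3 all3 q
      by (auto intro!: br)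
  qed
  moreover have "p = q" if p: "p \<in> ce_region a b c" for p
  proof -
    define x y where "x = ($) (p $ 1)" and "y = ($) (p $ 2)"
    have nn: "0 \<le> x i" "0 \<le> y i" for i using p by (auto simp: ce_region_def x_def y_def)
    have br: "0 \<le> (b i - b j) * x i + (c i - c j) * y i" for i j
      using p by (auto simp: ce_region_def x_def y_def)
    have pl1: "0 \<le> a k * x k + a l * x l + a m * x m" "a k * y k + a l * y l + a m * y m \<le> 0"
      using p by (auto simp: ce_region_def x_def y_def sum3)
    have tot: "x k + y k + (x l + y l) + (x m + y m) = 1"
      using p by (auto simp: ce_region_def x_def y_def sum3 total_def)
    have "(b k - b l) * x k + (c k - c l) * y k = (c l - c k) * (\<rho> * x k - y k)"
      by (simp only: \<rho>(2)) (simp add: algebra_simps)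
    then have yk: "y k \<le> \<rho> * x k" using br[of k l] c by (simp add: zero_le_mult_iff)
    have "(b l - b k) * x l + (c l - c k) * y l = (c l - c k) * (y l - \<rho> * x l)"
    proof -
      have "b l - b k = - (\<rho> * (c l - c k))" using \<rho>(2) by simp
      then show ?thesis by (simp only:) (simp add: algebra_simps)
    qed
    then have yl: "\<rho> * x l \<le> y l" using br[of l k] c by (simp add: zero_le_mult_iff)
    \<comment> \<open>On the far side of the ray, column \<open>m\<close> loses against \<open>l\<close> (if \<open>a m < 0\<close>) or \<open>k\<close>: the payoff
      difference splits into its value on the ray and a remainder, both of the wrong sign.\<close>
    have ym: "0 < a m * (y m - \<rho> * x m) \<or> x m = 0 \<and> y m = 0"
    proof (cases "a m < 0")
      case True
      show ?thesis
      proof (cases "y m < \<rho> * x m")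
        case False
        have "0 \<le> (b m + \<rho> * c m - (b l + \<rho> * c l)) * x m + (c m - c l) * (y m - \<rho> * x m)"
          using br[of m l] by (simp add: algebra_simps)
        moreover have "(b m + \<rho> * c m - (b l + \<rho> * c l)) * x m \<le> 0"
          using ml nn by (intro mult_nonpos_nonneg) auto
        moreover have "(c m - c l) * (y m - \<rho> * x m) \<le> 0"
          using m_neg[OF True] False by (intro mult_nonpos_nonneg) auto
        ultimately have "(b m + \<rho> * c m - (b l + \<rho> * c l)) * x m = 0" "(c m - c l) * (y m - \<rho> * x m) = 0"
          by linarith+
        then show ?thesis using ml m_neg[OF True] by auto
      qed (use True in \<open>simp add: mult_neg_neg\<close>)
    next
      case False
      then have pos: "0 < a m" using a by simp
      show ?thesis
      proof (cases "\<rho> * x m < y m")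
        case False
        have "0 \<le> \<rho> * ((b m - b k) * x m + (c m - c k) * y m)" using br[of m k] \<rho> by simp
        then have "0 \<le> (b m + \<rho> * c m - (b k + \<rho> * c k)) * y m + (b m - b k) * (\<rho> * x m - y m)"
          by (simp add: algebra_simps)
        moreover have "(b m + \<rho> * c m - (b k + \<rho> * c k)) * y m \<le> 0"
          using m nn by (intro mult_nonpos_nonneg) auto
        moreover have "(b m - b k) * (\<rho> * x m - y m) \<le> 0"
          using m_pos[OF pos] False by (intro mult_nonpos_nonneg) auto
        ultimately have "(b m + \<rho> * c m - (b k + \<rho> * c k)) * y m = 0" "(b m - b k) * (\<rho> * x m - y m) = 0"
          by linarith+
        then show ?thesis using m m_pos[OF pos] \<rho> by auto
      qed (use pos in simp)
    qed
    have "0 \<le> \<rho> * (a k * x k + a l * x l + a m * x m)" using pl1 \<rho> by simp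
    then have le: "a k * (y k - \<rho> * x k) + a l * (y l - \<rho> * x l) + a m * (y m - \<rho> * x m) \<le> 0"
      using pl1(2) by (simp add: algebra_simps)
    have nnk: "0 \<le> a k * (y k - \<rho> * x k)" using a(1) yk by (intro mult_nonpos_nonpos) auto
    have nnl: "0 \<le> a l * (y l - \<rho> * x l)" using a(2) yl by simp
    have xym: "x m = 0" "y m = 0" using ym le nnk nnl by linarith+
    then have "a k * (y k - \<rho> * x k) + a l * (y l - \<rho> * x l) \<le> 0" using le by simp
    then have "a k * (y k - \<rho> * x k) = 0" "a l * (y l - \<rho> * x l) = 0" using nnk nnl by linarith+
    then have ykl: "y k = \<rho> * x k" "y l = \<rho> * x l" using a by auto
    have "\<rho> * (a k * x k + a l * x l) \<le> 0" using pl1(2) xym ykl by (simp add: algebra_simps)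
    then have bal: "a k * x k + a l * x l = 0" using pl1(1) xym \<rho> by (simp add: mult_le_0_iff)
    have sum: "(1 + \<rho>) * (x k + x l) = 1" using tot xym ykl by (simp add: algebra_simps)
    have diff: "x k + x l = X + Y" using sum XYsum \<rho> by (metis add_pos_pos less_numeral_extra(1,3) mult_left_cancel)
    have "(a l - a k) * x k = a l * (x k + x l)" using bal by (simp add: algebra_simps)
    also have "\<dots> = (a l - a k) * X" unfolding diff using XYbal by (simp add: algebra_simps)
    finally have "x k = X" using a by simp
    moreover from this diff have "x l = Y" by simp
    ultimately show ?thesis
      using xym ykl q by (simp add: vec_eq_iff forall_2 all3 x_def y_def)
  qed
  ultimately show ?thesis by blast
qed

section \<open>Reduction to games with two columns\<close>

text \<open>
  Columns that are never a best reply carry no weight in any correlated equilibrium. Conversely,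
  filling them with zeros creates no new profitable deviation: if some column beats \<open>\<kappa> i\<close> then so
  does an overall best reply, which is one of the columns that are kept.
\<close>

lemma ce_region_delete_columns:
  fixes \<kappa> :: "'n::finite \<Rightarrow> 'm::finite"
  assumes inj: "inj \<kappa>"
    and zero: "\<And>k x y. k \<notin> range \<kappa> \<Longrightarrow> 0 \<le> x \<Longrightarrow> 0 \<le> y \<Longrightarrow>
      \<forall>l. 0 \<le> (b k - b l) * x + (c k - c l) * y \<Longrightarrow> x = 0 \<and> y = 0"
  shows "combinatorially_equivalent (ce_region (a \<circ> \<kappa>) (b \<circ> \<kappa>) (c \<circ> \<kappa>)) (ce_region a b c)"
proof -
  define g :: "real ^ 'n ^ 2 \<Rightarrow> real ^ 'm ^ 2" where
    "g p = (\<chi> j k. if k \<in> range \<kappa> then p $ j $ inv \<kappa> k else 0)" for p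
  have g_in: "g p $ j $ \<kappa> i = p $ j $ i" for p j i
    using inj by (simp add: g_def)
  have g_out: "g p $ j $ k = 0" if "k \<notin> range \<kappa>" for p j k
    using that by (simp add: g_def)
  have sum: "(\<Sum>k\<in>UNIV. u k * g p $ j $ k) = (\<Sum>i\<in>UNIV. u (\<kappa> i) * p $ j $ i)" for u p j
  proof -
    have "(\<Sum>k\<in>UNIV. u k * g p $ j $ k) = (\<Sum>k\<in>range \<kappa>. u k * g p $ j $ k)"
      by (rule sum.mono_neutral_right) (auto simp: g_out)
    also have "\<dots> = (\<Sum>i\<in>UNIV. u (\<kappa> i) * p $ j $ i)"
      using inj by (subst sum.reindex) (auto simp: g_in)
    finally show ?thesis .
  qed
  have total_g: "total (g p) = total p" for p
    using sum[where u = "\<lambda>_. 1"] by (simp add: total_def sum.distrib)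
  have "linear g"
    by (rule linearI) (auto simp: g_def vec_eq_iff)
  moreover have "inj g"
    by (rule injI) (metis g_in vec_eq_iff)
  moreover have "g ` ce_region (a \<circ> \<kappa>) (b \<circ> \<kappa>) (c \<circ> \<kappa>) = ce_region a b c"
  proof (intro equalityI subsetI)
    fix p' assume "p' \<in> g ` ce_region (a \<circ> \<kappa>) (b \<circ> \<kappa>) (c \<circ> \<kappa>)"
    then obtain p where p': "p' = g p" and p: "p \<in> ce_region (a \<circ> \<kappa>) (b \<circ> \<kappa>) (c \<circ> \<kappa>)" by blast
    have nn: "0 \<le> p $ 1 $ i" "0 \<le> p $ 2 $ i" for i using p by (auto simp: ce_region_def)
    have "0 \<le> (b (\<kappa> i) - b k) * p $ 1 $ i + (c (\<kappa> i) - c k) * p $ 2 $ i" for i k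
    proof -
      define v where "v l = b l * p $ 1 $ i + c l * p $ 2 $ i" for l
      have br: "v (\<kappa> i') \<le> v (\<kappa> i)" for i'
        using p by (auto simp: ce_region_def v_def algebra_simps)
      have "Max (range v) \<in> range v" by (rule Max_in) auto
      then obtain k' where k': "Max (range v) = v k'" by blast
      have k'max: "v l \<le> v k'" for l using Max_ge[of "range v" "v l"] k' by simp
      have "v k \<le> v (\<kappa> i)"
      proof (cases "k' \<in> range \<kappa>")
        case True
        then show ?thesis using br k'max by (metis imageE order_trans)
      next
        case False
        have "\<forall>l. 0 \<le> (b k' - b l) * p $ 1 $ i + (c k' - c l) * p $ 2 $ i"
          using k'max by (simp add: v_def algebra_simps)
        from zero[OF False nn this] show ?thesis by (simp add: v_def)
      qed
      then show ?thesis by (simp add: v_def algebra_simps)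
    qed
    then have "0 \<le> (b k - b l) * g p $ 1 $ k + (c k - c l) * g p $ 2 $ k" for k l
      by (cases "k \<in> range \<kappa>") (auto simp: g_in g_out)
    moreover have "0 \<le> g p $ 1 $ k \<and> 0 \<le> g p $ 2 $ k" for k
      using nn by (cases "k \<in> range \<kappa>") (auto simp: g_in g_out)
    ultimately show "p' \<in> ce_region a b c"
      using p by (simp add: ce_region_def p' sum total_g)
  next
    fix p assume p: "p \<in> ce_region a b c"
    define q :: "real ^ 'n ^ 2" where "q = (\<chi> j i. p $ j $ \<kappa> i)"
    have out: "p $ 1 $ k = 0 \<and> p $ 2 $ k = 0" if "k \<notin> range \<kappa>" for k
      using p by (intro zero[OF that]) (auto simp: ce_region_def)
    have gq: "g q = p"
    proof -
      have "g q $ j $ k = p $ j $ k" for j k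
      proof (cases "k \<in> range \<kappa>")
        case True
        then show ?thesis by (auto simp: g_in q_def)
      next
        case False
        then show ?thesis using out[OF False] exhaust_2[of j] by (auto simp: g_out)
      qed
      then show ?thesis by (simp add: vec_eq_iff)
    qed
    have "q \<in> ce_region (a \<circ> \<kappa>) (b \<circ> \<kappa>) (c \<circ> \<kappa>)"
      using p total_g[of q] sum[of a q 1] sum[of a q 2]
      by (auto simp: ce_region_def gq) (auto simp: q_def)
    then show "p \<in> g ` ce_region (a \<circ> \<kappa>) (b \<circ> \<kappa>) (c \<circ> \<kappa>)" using gq by blast
  qed
  ultimately show ?thesis using combinatorially_equivalent_linear_image by metis
qed

lemma ball_lessThan_8:
  "(\<forall>i\<in>{..<8::nat}. P i) \<longleftrightarrow> P 0 \<and> P 1 \<and> P 2 \<and> P 3 \<and> P 4 \<and> P 5 \<and> P 6 \<and> P 7"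
proof -
  have "{..<8::nat} = {0, 1, 2, 3, 4, 5, 6, 7}" by auto
  then show ?thesis by simp
qed

text \<open>
  Two columns with \<open>a 1 > 0 > a 2\<close> behave like a coordination game, which has a correlated
  equilibrium that satisfies all inequalities strictly.
\<close>

lemma aff_dim_ce_region_2:
  fixes a b c :: "2 \<Rightarrow> real"
  assumes "0 < a 1" "a 2 < 0" "b 2 < b 1" "c 1 < c 2"
  shows "aff_dim (ce_region a b c) = 3"
proof -
  define f :: "nat \<Rightarrow> real ^ 2 ^ 2 \<Rightarrow> real" where
    "f i p = [p $ 1 $ 1, p $ 1 $ 2, p $ 2 $ 1, p $ 2 $ 2,
       a 1 * p $ 1 $ 1 + a 2 * p $ 1 $ 2, - (a 1 * p $ 2 $ 1 + a 2 * p $ 2 $ 2),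
       (b 1 - b 2) * p $ 1 $ 1 + (c 1 - c 2) * p $ 2 $ 1,
       (b 2 - b 1) * p $ 1 $ 2 + (c 2 - c 1) * p $ 2 $ 2] ! i" for i p
  have lin: "\<forall>i\<in>{..<8}. linear (f i)"
    unfolding ball_lessThan_8 f_def
    by (auto intro!: linearI simp: algebra_simps)
  define \<rho> where "\<rho> = (b 1 - b 2) / (c 2 - c 1)"
  have \<rho>: "0 < \<rho>" "b 1 - b 2 = \<rho> * (c 2 - c 1)" using assms by (auto simp: \<rho>_def)
  \<comment> \<open>Column 1 gets weights of slope \<open>\<rho> / 2\<close> and column 2 of slope \<open>2 * \<rho>\<close>, on either side of the ray of
    slope \<open>\<rho>\<close> that separates the two sectors; the factors \<open>u\<close> and \<open>w\<close> cancel \<open>a 1\<close> and \<open>- a 2\<close>.\<close>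
  define u w where "u = 1 / a 1" and "w = - (1 / a 2)"
  have uw: "0 < u" "0 < w" "a 1 * u = 1" "a 2 * w = - 1" using assms by (auto simp: u_def w_def)
  define q :: "real ^ 2 ^ 2" where
    "q = (\<chi> j k. if j = 1 then (if k = 1 then 2 * u else w) else (if k = 1 then \<rho> * u else 2 * \<rho> * w))"
  have q: "q $ 1 $ 1 = 2 * u" "q $ 1 $ 2 = w" "q $ 2 $ 1 = \<rho> * u" "q $ 2 $ 2 = 2 * \<rho> * w"
    by (auto simp: q_def)
  have "0 < \<rho> * u" "0 < \<rho> * w" using uw \<rho> by auto
  then have "0 < total q" using uw by (simp add: total_def sum_2 q)
  moreover have "\<forall>i\<in>{..<8}. 0 < f i q"
  proof -
    have "a 1 * (2 * u) + a 2 * w = 1" using uw by simp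
    then have p1: "0 < a 1 * (2 * u) + a 2 * w" by simp
    have "- (a 1 * (\<rho> * u) + a 2 * (2 * \<rho> * w)) = - (\<rho> * (a 1 * u) + 2 * \<rho> * (a 2 * w))"
      by (simp add: algebra_simps)
    then have p2: "0 < - (a 1 * (\<rho> * u) + a 2 * (2 * \<rho> * w))" using uw \<rho>(1) by simp
    have "(b 1 - b 2) * (2 * u) + (c 1 - c 2) * (\<rho> * u) = (c 2 - c 1) * (\<rho> * u)"
      unfolding \<rho>(2) by (simp add: algebra_simps)
    moreover have "0 < (c 2 - c 1) * (\<rho> * u)" "0 < (c 2 - c 1) * (\<rho> * w)"
      using assms uw \<rho>(1) by simp_all
    moreover have "(b 2 - b 1) * w + (c 2 - c 1) * (2 * \<rho> * w) = (c 2 - c 1) * (\<rho> * w)"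
    proof -
      have "b 2 - b 1 = - (\<rho> * (c 2 - c 1))" using \<rho>(2) by simp
      then show ?thesis by (simp only:) (simp add: algebra_simps)
    qed
    ultimately have "0 < (b 1 - b 2) * (2 * u) + (c 1 - c 2) * (\<rho> * u)"
      "0 < (b 2 - b 1) * w + (c 2 - c 1) * (2 * \<rho> * w)"
      by linarith+
    note this p1 p2
    then show ?thesis
      using \<rho>(1) uw \<open>0 < \<rho> * u\<close> \<open>0 < \<rho> * w\<close> unfolding ball_lessThan_8 f_def
      by (simp add: q)
  qed
  moreover have "ce_region a b c = cone_slice total {..<8} f"
    unfolding ce_region_def cone_slice_def ball_lessThan_8 f_def
    by (auto simp: forall_2 sum_2)
  ultimately show ?thesis
    using aff_dim_cone_slice[OF linear_total finite_lessThan lin, of q] by simp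
qed

section \<open>Polytopes with the octagonal Gale diagram\<close>

definition exact_supports :: "((nat \<Rightarrow> real) \<Rightarrow> bool) \<Rightarrow> nat set set" where
  "exact_supports R =
     {{i \<in> {..<8}. 0 < z i} | z. (\<forall>i\<in>{..<8}. 0 \<le> z i) \<and> (\<exists>i\<in>{..<8}. 0 < z i) \<and> R z}"

lemma exact_supportsI:
  assumes "\<forall>i\<in>{..<8}. 0 \<le> z i" "\<exists>i\<in>{..<8}. 0 < z i" "R z" "S = {i \<in> {..<8}. 0 < z i}"
  shows "S \<in> exact_supports R"
  unfolding exact_supports_def mem_Collect_eq
  by (intro exI[of _ z] conjI) (fact assms)+

lemma exact_supportsE:
  assumes "S \<in> exact_supports R"
  obtains z where "\<forall>i\<in>{..<8}. 0 \<le> z i" "\<exists>i\<in>{..<8}. 0 < z i" "R z" "S = {i \<in> {..<8}. 0 < z i}"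
  using assms unfolding exact_supports_def mem_Collect_eq by (elim exE conjE) (rule that)

text \<open>
  The eight coordinates are grouped into pairs, one for each of four lines through the origin in the
  plane. A coordinate with sign \<open>+\<close> or \<open>-\<close> belongs to a vector on the positive or negative half of its
  line, and the condition says that some positive combination of the vectors in the support vanishes.
\<close>

definition gale_pattern :: "real \<Rightarrow> real \<Rightarrow> real \<Rightarrow> (nat \<Rightarrow> real) \<Rightarrow> bool" where
  "gale_pattern s1 s2 s3 z \<longleftrightarrow>
     alternating (s1 * z 0 - z 1) (s1 * z 2 + s2 * z 3) (s2 * z 4 + s3 * z 5) (s3 * z 6 + z 7)"

text \<open>
  For the signs \<open>1, - 1, 1\<close> the first three pairs consist of opposite vectors while the vectors of
  the last pair point the same way. The Gale diagram of \<open>P\<close> then looks like the vertices of a regular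
  octagon of which one is missing and its antipode is doubled.
\<close>

definition octagonal :: "(real ^ 'm::finite ^ 2) set \<Rightarrow> bool" where
  "octagonal P \<longleftrightarrow> (\<exists>f :: nat \<Rightarrow> real ^ 'm ^ 2 \<Rightarrow> real. (\<forall>i\<in>{..<8}. linear (f i)) \<and>
     P = cone_slice total {..<8} f \<and>
     positive_set {..<8} f ` P = exact_supports (gale_pattern 1 (- 1) 1))"

lemma combinatorially_equivalent_if_octagonal:
  assumes "octagonal P" "octagonal Q"
  shows "combinatorially_equivalent P Q"
proof -
  obtain f where f: "\<forall>i\<in>{..<8::nat}. linear (f i)" "P = cone_slice total {..<8} f"
      "positive_set {..<8} f ` P = exact_supports (gale_pattern 1 (- 1) 1)"
    using assms(1) unfolding octagonal_def by (elim exE conjE)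
  obtain g where g: "\<forall>i\<in>{..<8::nat}. linear (g i)" "Q = cone_slice total {..<8} g"
      "positive_set {..<8} g ` Q = exact_supports (gale_pattern 1 (- 1) 1)"
    using assms(2) unfolding octagonal_def by (elim exE conjE)
  have "positive_set {..<8} f ` cone_slice total {..<8} f = positive_set {..<8} g ` cone_slice total {..<8} g"
    unfolding f(2)[symmetric] g(2)[symmetric] f(3) g(3) by (rule refl)
  then show ?thesis
    unfolding f(2) g(2)
    by (rule combinatorially_equivalent_if_same_supports
        [OF finite_lessThan linear_total f(1) linear_total g(1)])
qed

lemma aff_dim_octagonal:
  assumes "octagonal (P :: (real ^ 'm::finite ^ 2) set)"
  shows "aff_dim P = 2 * int CARD('m) - 1"
proof -
  obtain f where f: "\<forall>i\<in>{..<8::nat}. linear (f i)" "P = cone_slice total {..<8} f"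
      "positive_set {..<8} f ` P = exact_supports (gale_pattern 1 (- 1) 1)"
    using assms unfolding octagonal_def by (elim exE conjE)
  \<comment> \<open>positive everywhere, with line sums \<open>- 1, 1, - 1, 2\<close>\<close>
  define z :: "nat \<Rightarrow> real" where "z i = [1, 2, 2, 1, 2, 1, 1, 1] ! i" for i
  have pos: "\<forall>i\<in>{..<8}. 0 < z i"
    unfolding ball_lessThan_8 by (simp add: z_def)
  have "{..<8} \<in> exact_supports (gale_pattern 1 (- 1) 1)"
  proof (rule exact_supportsI)
    show "\<forall>i\<in>{..<8}. 0 \<le> z i" using pos by (simp add: less_imp_le)
    show "\<exists>i\<in>{..<8}. 0 < z i" using pos by (intro bexI[of _ 0]) auto
    show "gale_pattern 1 (- 1) 1 z" by (simp add: z_def gale_pattern_def alternating_def)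
    show "{..<8} = {i \<in> {..<8}. 0 < z i}" using pos by blast
  qed
  then have "{..<8} \<in> positive_set {..<8} f ` P" unfolding f(3) .
  then obtain p where p: "p \<in> P" "positive_set {..<8} f p = {..<8}" by (metis imageE)
  have "0 < f i p" if "i \<in> {..<8}" for i
    using p(2) that unfolding positive_set_def by blast
  moreover have "0 < total p" using p(1) f(2) by (simp add: cone_slice_def)
  ultimately have "aff_dim P = int DIM(real ^ 'm ^ 2) - 1"
    unfolding f(2) by (rule aff_dim_cone_slice[OF linear_total finite_lessThan f(1), rotated])
  then show ?thesis by simp
qed

lemma octagonal_reindex:
  fixes f :: "nat \<Rightarrow> real ^ 'm::finite ^ 2 \<Rightarrow> real"
  assumes lin: "\<forall>i\<in>{..<8}. linear (f i)" and P: "P = cone_slice total {..<8} f"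
    and supp: "positive_set {..<8} f ` P = exact_supports R"
    and \<pi>: "\<forall>i\<in>{..<8}. \<pi> i < 8 \<and> \<pi>' i < 8 \<and> \<pi> (\<pi>' i) = i \<and> \<pi>' (\<pi> i) = i"
    and R: "\<And>z. R z \<Longrightarrow> gale_pattern 1 (- 1) 1 (\<lambda>i. z (\<pi> i))"
    and R': "\<And>z. gale_pattern 1 (- 1) 1 z \<Longrightarrow> R (\<lambda>i. z (\<pi>' i))"
  shows "octagonal P"
  unfolding octagonal_def
proof (intro exI conjI)
  let ?g = "\<lambda>i. f (\<pi> i)" and ?S = "\<lambda>z :: nat \<Rightarrow> real. {i \<in> {..<8}. 0 < z i}"
  have surj: "\<exists>j\<in>{..<8}. i = \<pi> j" "\<exists>j\<in>{..<8}. i = \<pi>' j" if "i \<in> {..<8}" for i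
    using \<pi> that by (auto intro: bexI[of _ "\<pi>' i"] bexI[of _ "\<pi> i"])
  show "\<forall>i\<in>{..<8}. linear (?g i)" using lin \<pi> by simp
  have "(\<forall>i\<in>{..<8}. 0 \<le> f i p) \<longleftrightarrow> (\<forall>i\<in>{..<8}. 0 \<le> ?g i p)" for p
  proof
    show "\<forall>i\<in>{..<8}. 0 \<le> f i p" if g: "\<forall>i\<in>{..<8}. 0 \<le> ?g i p"
    proof
      fix i :: nat assume "i \<in> {..<8}"
      then obtain j where "j \<in> {..<8}" "i = \<pi> j" using surj(1) by blast
      then show "0 \<le> f i p" using g by blast
    qed
  qed (use \<pi> in simp)
  then show "P = cone_slice total {..<8} ?g"
    unfolding P cone_slice_def by simp
  have pos: "positive_set {..<8} ?g p = {i \<in> {..<8}. \<pi> i \<in> positive_set {..<8} f p}" for p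
    using \<pi> by (auto simp: positive_set_def)
  show "positive_set {..<8} ?g ` P = exact_supports (gale_pattern 1 (- 1) 1)"
  proof (intro equalityI subsetI)
    fix S assume "S \<in> positive_set {..<8} ?g ` P"
    then obtain p where p: "p \<in> P" "S = positive_set {..<8} ?g p" by (rule imageE)
    have "positive_set {..<8} f p \<in> exact_supports R" using p(1) supp by blast
    then obtain z where z: "\<forall>i\<in>{..<8}. 0 \<le> z i" "\<exists>i\<in>{..<8}. 0 < z i" "R z" "positive_set {..<8} f p = ?S z"
      by (rule exact_supportsE)
    show "S \<in> exact_supports (gale_pattern 1 (- 1) 1)"
    proof (rule exact_supportsI[of "\<lambda>i. z (\<pi> i)"])
      show "gale_pattern 1 (- 1) 1 (\<lambda>i. z (\<pi> i))" by (rule R[OF z(3)])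
      show "\<forall>i\<in>{..<8}. 0 \<le> z (\<pi> i)" using z(1) \<pi> by simp
      obtain i where "i \<in> {..<8}" "0 < z i" using z(2) by (rule bexE)
      moreover from this obtain j where "j \<in> {..<8}" "i = \<pi> j" using surj(1) by blast
      ultimately show "\<exists>i\<in>{..<8}. 0 < z (\<pi> i)" by blast
      show "S = {i \<in> {..<8}. 0 < z (\<pi> i)}" unfolding p(2) pos z(4) using \<pi> by auto
    qed
  next
    fix S assume "S \<in> exact_supports (gale_pattern 1 (- 1) 1)"
    then obtain z where z: "\<forall>i\<in>{..<8}. 0 \<le> z i" "\<exists>i\<in>{..<8}. 0 < z i" "gale_pattern 1 (- 1) 1 z" "S = ?S z"
      by (rule exact_supportsE)
    have "?S (\<lambda>i. z (\<pi>' i)) \<in> exact_supports R"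
    proof (rule exact_supportsI[of "\<lambda>i. z (\<pi>' i)"])
      show "R (\<lambda>i. z (\<pi>' i))" by (rule R'[OF z(3)])
      show "\<forall>i\<in>{..<8}. 0 \<le> z (\<pi>' i)" using z(1) \<pi> by simp
      obtain i where "i \<in> {..<8}" "0 < z i" using z(2) by (rule bexE)
      moreover from this obtain j where "j \<in> {..<8}" "i = \<pi>' j" using surj(2) by blast
      ultimately show "\<exists>i\<in>{..<8}. 0 < z (\<pi>' i)" by blast
      show "?S (\<lambda>i. z (\<pi>' i)) = ?S (\<lambda>i. z (\<pi>' i))" by (rule refl)
    qed
    then have "?S (\<lambda>i. z (\<pi>' i)) \<in> positive_set {..<8} f ` P" unfolding supp .
    then obtain p where p: "?S (\<lambda>i. z (\<pi>' i)) = positive_set {..<8} f p" "p \<in> P" by (rule imageE)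
    have "positive_set {..<8} ?g p = S" unfolding pos p(1)[symmetric] z(4) using \<pi> by auto
    then show "S \<in> positive_set {..<8} ?g ` P" using p(2) by blast
  qed
qed

section \<open>Games with three best-reply sectors\<close>

text \<open>
  Column \<open>k1\<close> is a best reply to \<open>(x, y)\<close> if \<open>y \<le> \<sigma> x\<close>, column \<open>k2\<close> if \<open>\<sigma> x \<le> y \<le> \<tau> x\<close>, and column \<open>k3\<close>
  if \<open>\<tau> x \<le> y\<close>.
\<close>

locale three_sectors =
  fixes a b c :: "3 \<Rightarrow> real" and \<sigma> \<tau> :: real and k1 k2 k3 :: 3
  assumes distinct: "k1 \<noteq> k2" "k1 \<noteq> k3" "k2 \<noteq> k3"
    and slopes: "0 < \<sigma>" "\<sigma> < \<tau>"
    and b12: "b k1 - b k2 = \<sigma> * (c k2 - c k1)" and b23: "b k2 - b k3 = \<tau> * (c k3 - c k2)"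
    and c_less: "c k1 < c k2" "c k2 < c k3"
    and a_nonzero: "a k1 \<noteq> 0" "a k2 \<noteq> 0" "a k3 \<noteq> 0"
begin

lemmas sum3 = sum_UNIV_3[OF distinct] and all3 = all_UNIV_3[OF distinct]

text \<open>
  Coordinates 0, 2 and 3, 4 and 5, 6 expand the weights of \<open>k1\<close>, \<open>k2\<close>, \<open>k3\<close> in the two rays that bound
  the sector of the column, namely \<open>(1,0)\<close>, \<open>(1,\<sigma>)\<close>; \<open>(1,\<sigma>)\<close>, \<open>(1,\<tau>)\<close>; \<open>(1,\<tau>)\<close>, \<open>(0,1)\<close>. They are scaled by
  \<open>\<bar>a k\<bar>\<close> so that only the signs of \<open>a\<close> remain in the relations between the coordinates. Coordinates
  1 and 7 are the two incentives of player 1; they sit next to the rays \<open>(1,0)\<close> and \<open>(0,1)\<close> because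
  their vectors in the Gale diagram lie on the corresponding lines.
\<close>

definition coord :: "nat \<Rightarrow> real ^ 3 ^ 2 \<Rightarrow> real" where
  "coord i p =
    [\<bar>a k1\<bar> * (p $ 1 $ k1 - p $ 2 $ k1 / \<sigma>),
     a k1 * p $ 1 $ k1 + a k2 * p $ 1 $ k2 + a k3 * p $ 1 $ k3,
     \<bar>a k1\<bar> * (p $ 2 $ k1 / \<sigma>),
     \<bar>a k2\<bar> * ((\<tau> * p $ 1 $ k2 - p $ 2 $ k2) / (\<tau> - \<sigma>)),
     \<bar>a k2\<bar> * ((p $ 2 $ k2 - \<sigma> * p $ 1 $ k2) / (\<tau> - \<sigma>)),
     \<bar>a k3\<bar> * p $ 1 $ k3,
     \<bar>a k3\<bar> * (p $ 2 $ k3 - \<tau> * p $ 1 $ k3),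
     - (a k1 * p $ 2 $ k1 + a k2 * p $ 2 $ k2 + a k3 * p $ 2 $ k3)] ! i"

lemma coord_simps:
  "coord 0 p = \<bar>a k1\<bar> * (p $ 1 $ k1 - p $ 2 $ k1 / \<sigma>)"
  "coord 1 p = a k1 * p $ 1 $ k1 + a k2 * p $ 1 $ k2 + a k3 * p $ 1 $ k3"
  "coord 2 p = \<bar>a k1\<bar> * (p $ 2 $ k1 / \<sigma>)"
  "coord 3 p = \<bar>a k2\<bar> * ((\<tau> * p $ 1 $ k2 - p $ 2 $ k2) / (\<tau> - \<sigma>))"
  "coord 4 p = \<bar>a k2\<bar> * ((p $ 2 $ k2 - \<sigma> * p $ 1 $ k2) / (\<tau> - \<sigma>))"
  "coord 5 p = \<bar>a k3\<bar> * p $ 1 $ k3"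
  "coord 6 p = \<bar>a k3\<bar> * (p $ 2 $ k3 - \<tau> * p $ 1 $ k3)"
  "coord 7 p = - (a k1 * p $ 2 $ k1 + a k2 * p $ 2 $ k2 + a k3 * p $ 2 $ k3)"
  by (simp_all add: coord_def)

lemma linear_coord: "\<forall>i\<in>{..<8}. linear (coord i)"
  unfolding ball_lessThan_8
  by (intro conjI linearI) (simp_all add: coord_simps algebra_simps add_divide_distrib diff_divide_distrib del: One_nat_def)

lemma best_reply_1:
  assumes "0 \<le> x" "0 \<le> y"
  shows "(\<forall>l. 0 \<le> (b k1 - b l) * x + (c k1 - c l) * y) \<longleftrightarrow> y \<le> \<sigma> * x"
proof -
  define u v where "u = c k2 - c k1" and "v = c k3 - c k2"
  have uv: "0 < u" "0 < v" using c_less by (auto simp: u_def v_def)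
  have e: "b k1 - b k2 = \<sigma> * u" "c k1 - c k2 = - u" "b k1 - b k3 = \<sigma> * u + \<tau> * v" "c k1 - c k3 = - u - v"
    using b12 b23 by (auto simp: u_def v_def)
  have "\<sigma> * u * x + - u * y = u * (\<sigma> * x - y)" by (simp add: algebra_simps)
  then have 12: "0 \<le> \<sigma> * u * x + - u * y \<longleftrightarrow> y \<le> \<sigma> * x" using uv by (simp add: zero_le_mult_iff)
  have "(\<sigma> * u + \<tau> * v) * x + (- u - v) * y = u * (\<sigma> * x - y) + v * (\<tau> * x - y)" by (simp add: algebra_simps)
  moreover have "y \<le> \<tau> * x" if "y \<le> \<sigma> * x"
    using that slopes assms mult_right_mono[of \<sigma> \<tau> x] by linarith
  ultimately have 13: "0 \<le> (\<sigma> * u + \<tau> * v) * x + (- u - v) * y" if "y \<le> \<sigma> * x"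
    using that uv by simp
  show ?thesis unfolding all3 e using 12 13 by auto
qed

lemma best_reply_2:
  assumes "0 \<le> x" "0 \<le> y"
  shows "(\<forall>l. 0 \<le> (b k2 - b l) * x + (c k2 - c l) * y) \<longleftrightarrow> \<sigma> * x \<le> y \<and> y \<le> \<tau> * x"
proof -
  define u v where "u = c k2 - c k1" and "v = c k3 - c k2"
  have uv: "0 < u" "0 < v" using c_less by (auto simp: u_def v_def)
  have e: "b k2 - b k1 = - (\<sigma> * u)" "c k2 - c k1 = u" "b k2 - b k3 = \<tau> * v" "c k2 - c k3 = - v"
    using b12 b23 by (auto simp: u_def v_def)
  have "- (\<sigma> * u) * x + u * y = u * (y - \<sigma> * x)" by (simp add: algebra_simps)
  then have 12: "0 \<le> - (\<sigma> * u) * x + u * y \<longleftrightarrow> \<sigma> * x \<le> y" using uv by (simp add: zero_le_mult_iff)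
  have "\<tau> * v * x + - v * y = v * (\<tau> * x - y)" by (simp add: algebra_simps)
  then have 13: "0 \<le> \<tau> * v * x + - v * y \<longleftrightarrow> y \<le> \<tau> * x" using uv by (simp add: zero_le_mult_iff)
  show ?thesis unfolding all3 e using 12 13 by auto
qed

lemma best_reply_3:
  assumes "0 \<le> x" "0 \<le> y"
  shows "(\<forall>l. 0 \<le> (b k3 - b l) * x + (c k3 - c l) * y) \<longleftrightarrow> \<tau> * x \<le> y"
proof -
  define u v where "u = c k2 - c k1" and "v = c k3 - c k2"
  have uv: "0 < u" "0 < v" using c_less by (auto simp: u_def v_def)
  have e: "b k3 - b k1 = - (\<sigma> * u + \<tau> * v)" "c k3 - c k1 = u + v" "b k3 - b k2 = - (\<tau> * v)" "c k3 - c k2 = v"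
    using b12 b23 by (auto simp: u_def v_def)
  have "- (\<tau> * v) * x + v * y = v * (y - \<tau> * x)" by (simp add: algebra_simps)
  then have 12: "0 \<le> - (\<tau> * v) * x + v * y \<longleftrightarrow> \<tau> * x \<le> y" using uv by (simp add: zero_le_mult_iff)
  have "- (\<sigma> * u + \<tau> * v) * x + (u + v) * y = u * (y - \<sigma> * x) + v * (y - \<tau> * x)" by (simp add: algebra_simps)
  moreover have "\<sigma> * x \<le> y" if "\<tau> * x \<le> y"
    using that slopes assms mult_right_mono[of \<sigma> \<tau> x] by linarith
  ultimately have 13: "0 \<le> - (\<sigma> * u + \<tau> * v) * x + (u + v) * y" if "\<tau> * x \<le> y"
    using that uv by simp
  show ?thesis unfolding all3 e using 12 13 by auto
qed

lemma ce_region_eq_cone_slice: "ce_region a b c = cone_slice total {..<8} coord"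
proof -
  have "(\<forall>k. 0 \<le> p $ 1 $ k \<and> 0 \<le> p $ 2 $ k) \<and>
     (\<forall>k l. 0 \<le> (b k - b l) * p $ 1 $ k + (c k - c l) * p $ 2 $ k) \<longleftrightarrow>
     0 \<le> coord 0 p \<and> 0 \<le> coord 2 p \<and> 0 \<le> coord 3 p \<and> 0 \<le> coord 4 p \<and> 0 \<le> coord 5 p \<and> 0 \<le> coord 6 p"
    (is "?nn \<and> ?br \<longleftrightarrow> ?coord") for p
  proof -
    have pos: "0 < \<bar>a k1\<bar>" "0 < \<bar>a k2\<bar>" "0 < \<bar>a k3\<bar>" using a_nonzero by auto
    have "0 \<le> p $ 1 $ k1 - p $ 2 $ k1 / \<sigma> \<longleftrightarrow> p $ 2 $ k1 \<le> \<sigma> * p $ 1 $ k1"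
      using slopes by (simp add: field_simps)
    then have coord: "?coord \<longleftrightarrow> p $ 2 $ k1 \<le> \<sigma> * p $ 1 $ k1 \<and> 0 \<le> p $ 2 $ k1 \<and> p $ 2 $ k2 \<le> \<tau> * p $ 1 $ k2 \<and>
        \<sigma> * p $ 1 $ k2 \<le> p $ 2 $ k2 \<and> 0 \<le> p $ 1 $ k3 \<and> \<tau> * p $ 1 $ k3 \<le> p $ 2 $ k3"
      unfolding coord_simps using pos slopes
      by (simp add: zero_le_mult_iff zero_le_divide_iff)
    have nn: "?nn" if ?coord
    proof -
      have x2: "0 \<le> p $ 1 $ k2"
      proof -
        have "\<sigma> * p $ 1 $ k2 \<le> \<tau> * p $ 1 $ k2" using that unfolding coord by linarith
        then have "0 \<le> (\<tau> - \<sigma>) * p $ 1 $ k2" by (simp add: algebra_simps)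
        then show ?thesis using slopes by (simp add: zero_le_mult_iff)
      qed
      have "0 \<le> \<sigma> * p $ 1 $ k1" using that unfolding coord by linarith
      then have "0 \<le> p $ 1 $ k1" using slopes by (simp add: zero_le_mult_iff)
      moreover have "0 \<le> \<sigma> * p $ 1 $ k2" using x2 slopes by simp
      then have "0 \<le> p $ 2 $ k2" using that unfolding coord by linarith
      moreover have "0 \<le> \<tau> * p $ 1 $ k3" using that slopes unfolding coord by simp
      then have "0 \<le> p $ 2 $ k3" using that unfolding coord by linarith
      ultimately show ?thesis using that x2 unfolding coord all3 by blast
    qed
    have "?br \<longleftrightarrow> ?coord" if ?nn
    proof -
      have "?br \<longleftrightarrow> p $ 2 $ k1 \<le> \<sigma> * p $ 1 $ k1 \<and>
          (\<sigma> * p $ 1 $ k2 \<le> p $ 2 $ k2 \<and> p $ 2 $ k2 \<le> \<tau> * p $ 1 $ k2) \<and> \<tau> * p $ 1 $ k3 \<le> p $ 2 $ k3"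
        using that by (simp add: all3[of "\<lambda>k. \<forall>l. _ k l"] best_reply_1 best_reply_2 best_reply_3)
      then show ?thesis using that unfolding coord by auto
    qed
    then show ?thesis using nn by blast
  qed
  moreover have "0 \<le> (\<Sum>k\<in>UNIV. a k * p $ 1 $ k) \<longleftrightarrow> 0 \<le> coord 1 p"
    "(\<Sum>k\<in>UNIV. a k * p $ 2 $ k) \<le> 0 \<longleftrightarrow> 0 \<le> coord 7 p" for p
    unfolding coord_simps sum3 by linarith+
  ultimately show ?thesis
    unfolding ce_region_def cone_slice_def ball_lessThan_8 by blast
qed

text \<open>
  The two components of \<open>\<Sum>k. a k * (p $ 1 $ k, p $ 2 $ k)\<close>, collected by rays. Eight functionals on a
  space of dimension six satisfy two independent relations, and these are all of them.
\<close>

lemma coord_balanced: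
  defines "s1 \<equiv> sgn (a k1)" and "s2 \<equiv> sgn (a k2)" and "s3 \<equiv> sgn (a k3)"
  shows "(s1 * coord 0 p - coord 1 p) + (s1 * coord 2 p + s2 * coord 3 p) +
      (s2 * coord 4 p + s3 * coord 5 p) = 0"
    and "\<sigma> * (s1 * coord 2 p + s2 * coord 3 p) + \<tau> * (s2 * coord 4 p + s3 * coord 5 p) +
      (s3 * coord 6 p + coord 7 p) = 0"
proof -
  have s: "sgn r * (\<bar>r\<bar> * t) = r * t" for r t :: real by (simp add: sgn_mult_abs mult.assoc[symmetric])
  have "(\<tau> * x - y) / (\<tau> - \<sigma>) + (y - \<sigma> * x) / (\<tau> - \<sigma>) = x"
    "\<sigma> * ((\<tau> * x - y) / (\<tau> - \<sigma>)) + \<tau> * ((y - \<sigma> * x) / (\<tau> - \<sigma>)) = y" for x y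
  proof -
    have "(\<tau> * x - y) + (y - \<sigma> * x) = (\<tau> - \<sigma>) * x"
      "\<sigma> * (\<tau> * x - y) + \<tau> * (y - \<sigma> * x) = (\<tau> - \<sigma>) * y" by (simp_all add: algebra_simps)
    then show "(\<tau> * x - y) / (\<tau> - \<sigma>) + (y - \<sigma> * x) / (\<tau> - \<sigma>) = x"
      "\<sigma> * ((\<tau> * x - y) / (\<tau> - \<sigma>)) + \<tau> * ((y - \<sigma> * x) / (\<tau> - \<sigma>)) = y"
      using slopes by (simp_all only: times_divide_eq_right flip: add_divide_distrib) simp_all
  qed
  note mid = this[of "p $ 1 $ k2" "p $ 2 $ k2"]
  let ?g = "(\<tau> * p $ 1 $ k2 - p $ 2 $ k2) / (\<tau> - \<sigma>)" and ?d = "(p $ 2 $ k2 - \<sigma> * p $ 1 $ k2) / (\<tau> - \<sigma>)"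
  have "a k2 * ?g + a k2 * ?d = a k2 * p $ 1 $ k2" using mid(1) by (metis distrib_left)
  moreover have "\<sigma> * (a k2 * ?g) + \<tau> * (a k2 * ?d) = a k2 * (\<sigma> * ?g + \<tau> * ?d)" by (simp only: algebra_simps)
  moreover have "\<sigma> * (a k1 * (p $ 2 $ k1 / \<sigma>)) = a k1 * p $ 2 $ k1" using slopes by simp
  ultimately show "(s1 * coord 0 p - coord 1 p) + (s1 * coord 2 p + s2 * coord 3 p) +
      (s2 * coord 4 p + s3 * coord 5 p) = 0"
    "\<sigma> * (s1 * coord 2 p + s2 * coord 3 p) + \<tau> * (s2 * coord 4 p + s3 * coord 5 p) +
      (s3 * coord 6 p + coord 7 p) = 0"
    unfolding coord_simps s1_def s2_def s3_def s mid(2)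
    by (simp_all add: right_diff_distrib distrib_left)
qed

text \<open>
  The relations give the necessary condition. A given pattern, once rescaled line by line into
  an exact solution of the relations, consists of the coordinates of a unique matrix, which only has
  to be normalised.
\<close>

lemma positive_sets_coord:
  "positive_set {..<8} coord ` ce_region a b c =
     exact_supports (gale_pattern (sgn (a k1)) (sgn (a k2)) (sgn (a k3)))"
proof (intro equalityI subsetI)
  fix S assume "S \<in> positive_set {..<8} coord ` ce_region a b c"
  then obtain p where p: "p \<in> ce_region a b c" "S = positive_set {..<8} coord p" by blast
  define z where "z i = coord i p" for i
  have nn: "\<forall>i\<in>{..<8}. 0 \<le> z i" and tot: "total p = 1"
    using p(1) unfolding ce_region_eq_cone_slice cone_slice_def z_def by auto
  have "\<exists>i\<in>{..<8}. 0 < z i"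
  proof (rule ccontr)
    assume "\<not> ?thesis"
    then have "\<forall>i\<in>{..<8}. z i = 0" using nn by force
    then have "p $ 1 $ k1 = 0 \<and> p $ 2 $ k1 = 0 \<and> \<tau> * p $ 1 $ k2 = p $ 2 $ k2 \<and> p $ 2 $ k2 = \<sigma> * p $ 1 $ k2 \<and>
        p $ 1 $ k3 = 0 \<and> p $ 2 $ k3 = 0"
      using a_nonzero slopes unfolding ball_lessThan_8 z_def coord_simps by auto
    then have "total p = 0" using slopes by (auto simp: total_def sum3)
    then show False using tot by simp
  qed
  moreover have "gale_pattern (sgn (a k1)) (sgn (a k2)) (sgn (a k3)) z"
    unfolding gale_pattern_def z_def
    by (rule alternating_if_balanced[OF slopes coord_balanced])
  moreover have "S = {i \<in> {..<8}. 0 < z i}" using p(2) by (simp add: positive_set_def z_def)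
  ultimately show "S \<in> exact_supports (gale_pattern (sgn (a k1)) (sgn (a k2)) (sgn (a k3)))"
    using nn by (intro exact_supportsI[of z])
next
  fix S assume "S \<in> exact_supports (gale_pattern (sgn (a k1)) (sgn (a k2)) (sgn (a k3)))"
  then obtain z where z: "\<forall>i\<in>{..<8}. 0 \<le> z i" "\<exists>i\<in>{..<8}. 0 < z i"
    and pat: "gale_pattern (sgn (a k1)) (sgn (a k2)) (sgn (a k3)) z" and S: "S = {i \<in> {..<8}. 0 < z i}"
    by (rule exact_supportsE)
  obtain l0 l1 l2 l3 where l: "0 < l0" "0 < l1" "0 < l2" "0 < l3"
    and bal: "l0 * (sgn (a k1) * z 0 - z 1) + l1 * (sgn (a k1) * z 2 + sgn (a k2) * z 3) +
        l2 * (sgn (a k2) * z 4 + sgn (a k3) * z 5) = 0"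
      "\<sigma> * (l1 * (sgn (a k1) * z 2 + sgn (a k2) * z 3)) + \<tau> * (l2 * (sgn (a k2) * z 4 + sgn (a k3) * z 5)) +
        l3 * (sgn (a k3) * z 6 + z 7) = 0"
    using balanced_if_alternating[OF slopes pat[unfolded gale_pattern_def]] by blast
  \<comment> \<open>the factors are constant on lines, so they commute with the line sums and keep the support\<close>
  define w where "w i = [l0 * z 0, l0 * z 1, l1 * z 2, l1 * z 3, l2 * z 4, l2 * z 5, l3 * z 6, l3 * z 7] ! i" for i
  define x1 y1 x2 y2 x3 y3 where
    "x1 = (w 0 + w 2) / \<bar>a k1\<bar>" and "y1 = \<sigma> * w 2 / \<bar>a k1\<bar>" and
    "x2 = (w 3 + w 4) / \<bar>a k2\<bar>" and "y2 = (\<sigma> * w 3 + \<tau> * w 4) / \<bar>a k2\<bar>" and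
    "x3 = w 5 / \<bar>a k3\<bar>" and "y3 = (\<tau> * w 5 + w 6) / \<bar>a k3\<bar>"
  define q :: "real ^ 3 ^ 2" where
    "q = (\<chi> j k. if j = 1 then (if k = k1 then x1 else if k = k2 then x2 else x3)
                 else (if k = k1 then y1 else if k = k2 then y2 else y3))"
  have q: "q $ 1 $ k1 = x1" "q $ 1 $ k2 = x2" "q $ 1 $ k3 = x3" "q $ 2 $ k1 = y1" "q $ 2 $ k2 = y2" "q $ 2 $ k3 = y3"
    using distinct by (auto simp: q_def)
  have c023456: "coord 0 q = w 0" "coord 2 q = w 2" "coord 3 q = w 3" "coord 4 q = w 4" "coord 5 q = w 5" "coord 6 q = w 6"
  proof -
    have "\<bar>a k2\<bar> * ((\<tau> * x2 - y2) / (\<tau> - \<sigma>)) = (\<tau> * (\<bar>a k2\<bar> * x2) - \<bar>a k2\<bar> * y2) / (\<tau> - \<sigma>)"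
      "\<bar>a k2\<bar> * ((y2 - \<sigma> * x2) / (\<tau> - \<sigma>)) = (\<bar>a k2\<bar> * y2 - \<sigma> * (\<bar>a k2\<bar> * x2)) / (\<tau> - \<sigma>)"
      by (simp_all add: algebra_simps)
    moreover have "\<bar>a k2\<bar> * x2 = w 3 + w 4" "\<bar>a k2\<bar> * y2 = \<sigma> * w 3 + \<tau> * w 4"
      using a_nonzero by (simp_all add: x2_def y2_def)
    moreover have "\<tau> * (w 3 + w 4) - (\<sigma> * w 3 + \<tau> * w 4) = w 3 * (\<tau> - \<sigma>)"
      "\<sigma> * w 3 + \<tau> * w 4 - \<sigma> * (w 3 + w 4) = w 4 * (\<tau> - \<sigma>)" by (simp_all add: algebra_simps)
    ultimately show "coord 3 q = w 3" "coord 4 q = w 4"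
      unfolding coord_simps q using slopes by simp_all
    show "coord 0 q = w 0" "coord 2 q = w 2" "coord 5 q = w 5" "coord 6 q = w 6"
      unfolding coord_simps q x1_def y1_def x3_def y3_def using a_nonzero slopes
      by (simp_all add: field_simps)
  qed
  have c17: "coord 1 q = w 1" "coord 7 q = w 7"
    using coord_balanced[of q] bal unfolding c023456 by (simp_all add: w_def algebra_simps)
  have cw: "\<forall>i\<in>{..<8}. coord i q = w i" unfolding ball_lessThan_8 using c023456 c17 by simp
  have wz: "\<forall>i\<in>{..<8}. (0 < w i \<longleftrightarrow> 0 < z i)"
    unfolding ball_lessThan_8 using l by (simp add: w_def zero_less_mult_iff)
  have wnn: "\<forall>i\<in>{..<8}. 0 \<le> w i"
    using l z(1) unfolding ball_lessThan_8 by (simp add: w_def)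
  have "0 < total q"
  proof -
    have nn: "0 \<le> x1" "0 \<le> y1" "0 \<le> x2" "0 \<le> y2" "0 \<le> x3" "0 \<le> y3"
      using wnn slopes unfolding ball_lessThan_8 x1_def y1_def x2_def y2_def x3_def y3_def by auto
    have "total q \<noteq> 0"
    proof
      assume "total q = 0"
      then have "x1 + y1 + (x2 + y2) + (x3 + y3) = 0" by (simp add: total_def sum3 q)
      then have "x1 = 0" "y1 = 0" "x2 = 0" "y2 = 0" "x3 = 0" "y3 = 0" using nn by linarith+
      then have "\<forall>i\<in>{..<8}. coord i q = 0" unfolding ball_lessThan_8 coord_simps q by simp
      then show False using cw wz z(2) by force
    qed
    moreover have "0 \<le> total q" using nn by (simp add: total_def sum3 q)
    ultimately show ?thesis by simp
  qed
  define p where "p = (1 / total q) *\<^sub>R q"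
  have cp: "coord i p = coord i q / total q" if "i \<in> {..<8}" for i
    using linear_scale[OF bspec[OF linear_coord that], of "1 / total q" q] by (simp add: p_def)
  have "p \<in> ce_region a b c"
    unfolding ce_region_eq_cone_slice cone_slice_def
    using cp cw wnn \<open>0 < total q\<close> linear_scale[OF linear_total, of "1 / total q" q]
    by (auto simp: p_def)
  moreover have "positive_set {..<8} coord p = S"
    using cp cw wz \<open>0 < total q\<close> by (auto simp: positive_set_def S zero_less_divide_iff)
  ultimately show "S \<in> positive_set {..<8} coord ` ce_region a b c" by blast
qed

text \<open>
  The four sign patterns in which a \<open>+\<close> is directly followed by a \<open>-\<close> each have exactly one line whose
  two vectors agree, but at different places of the cyclic order. Rotating the diagram (and
  reflecting it at the origin) moves this line into the last place.
\<close>

lemma octagonal_ce_region: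
  assumes "0 < a k1 \<and> a k2 < 0 \<or> 0 < a k2 \<and> a k3 < 0"
  shows "octagonal (ce_region a b c)"
proof -
  note reindex = octagonal_reindex[OF linear_coord ce_region_eq_cone_slice positive_sets_coord]
  consider "0 < a k1" "a k2 < 0" "0 < a k3" | "0 < a k1" "0 < a k2" "a k3 < 0"
    | "a k1 < 0" "0 < a k2" "a k3 < 0" | "0 < a k1" "a k2 < 0" "a k3 < 0"
    using assms a_nonzero by linarith
  then show ?thesis
  proof cases
    case 1
    show ?thesis
      by (rule reindex[of "\<lambda>i. i" "\<lambda>i. i"]) (use 1 in auto)
  next
    case 2
    show ?thesis
    \<comment> \<open>a rotation by two steps and a change of all signs\<close>
    proof (rule reindex[of "(!) [5, 4, 6, 7, 1, 0, 2, 3]" "(!) [5, 4, 6, 7, 1, 0, 2, 3]"])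
      fix z :: "nat \<Rightarrow> real"
      have "alternating (z 0 - z 1) (z 2 + z 3) (z 4 - z 5) (z 7 - z 6) \<longleftrightarrow>
          alternating (z 5 - z 4) (z 6 - z 7) (z 0 - z 1) (z 2 + z 3)" for z :: "nat \<Rightarrow> real"
        using alternating_rotate[of "z 2 + z 3" "z 4 - z 5" "z 7 - z 6" "z 0 - z 1"]
          alternating_rotate[of "z 4 - z 5" "z 7 - z 6" "- (z 0 - z 1)" "z 2 + z 3"]
          alternating_uminus[of "z 4 - z 5" "z 7 - z 6" "- (z 0 - z 1)" "- (z 2 + z 3)"]
        by (simp only: minus_diff_eq minus_minus)
      note this[of z] this[of "\<lambda>i. z ([5, 4, 6, 7, 1, 0, 2, 3] ! i)"]
      then show "gale_pattern (sgn (a k1)) (sgn (a k2)) (sgn (a k3)) z \<Longrightarrow>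
          gale_pattern 1 (- 1) 1 (\<lambda>i. z ([5, 4, 6, 7, 1, 0, 2, 3] ! i))"
        "gale_pattern 1 (- 1) 1 z \<Longrightarrow> gale_pattern (sgn (a k1)) (sgn (a k2)) (sgn (a k3))
          (\<lambda>i. z ([5, 4, 6, 7, 1, 0, 2, 3] ! i))"
        using 2 by (simp_all add: gale_pattern_def)
    qed (simp add: ball_lessThan_8)
  next
    case 3
    show ?thesis
    \<comment> \<open>a rotation by one step\<close>
    proof (rule reindex[of "(!) [3, 2, 4, 5, 6, 7, 0, 1]" "(!) [6, 7, 1, 0, 2, 3, 4, 5]"])
      fix z :: "nat \<Rightarrow> real"
      have "alternating (- z 0 - z 1) (z 3 - z 2) (z 4 - z 5) (z 7 - z 6) \<longleftrightarrow>
          alternating (z 3 - z 2) (z 4 - z 5) (z 7 - z 6) (z 0 + z 1)" for z :: "nat \<Rightarrow> real"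
        using alternating_rotate[of "z 3 - z 2" "z 4 - z 5" "z 7 - z 6" "- z 0 - z 1"]
        by (simp add: add.commute)
      note this[of z] this[of "\<lambda>i. z ([6, 7, 1, 0, 2, 3, 4, 5] ! i)"]
      then show "gale_pattern (sgn (a k1)) (sgn (a k2)) (sgn (a k3)) z \<Longrightarrow>
          gale_pattern 1 (- 1) 1 (\<lambda>i. z ([3, 2, 4, 5, 6, 7, 0, 1] ! i))"
        "gale_pattern 1 (- 1) 1 z \<Longrightarrow> gale_pattern (sgn (a k1)) (sgn (a k2)) (sgn (a k3))
          (\<lambda>i. z ([6, 7, 1, 0, 2, 3, 4, 5] ! i))"
        using 3 by (simp_all add: gale_pattern_def)
    qed (simp add: ball_lessThan_8)
  next
    case 4
    show ?thesis
    \<comment> \<open>a rotation by three steps\<close>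
    proof (rule reindex[of "(!) [7, 6, 1, 0, 2, 3, 4, 5]" "(!) [3, 2, 4, 5, 6, 7, 1, 0]"])
      fix z :: "nat \<Rightarrow> real"
      have "alternating (z 0 - z 1) (z 2 - z 3) (- z 4 - z 5) (z 7 - z 6) \<longleftrightarrow>
          alternating (z 7 - z 6) (z 1 - z 0) (z 3 - z 2) (z 4 + z 5)" for z :: "nat \<Rightarrow> real"
        using alternating_rotate[of "z 1 - z 0" "z 3 - z 2" "z 4 + z 5" "z 7 - z 6"]
          alternating_uminus[of "z 0 - z 1" "z 2 - z 3" "- z 4 - z 5" "z 7 - z 6"]
        by (simp add: add.commute)
      note this[of z] this[of "\<lambda>i. z ([3, 2, 4, 5, 6, 7, 1, 0] ! i)"]
      then show "gale_pattern (sgn (a k1)) (sgn (a k2)) (sgn (a k3)) z \<Longrightarrow>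
          gale_pattern 1 (- 1) 1 (\<lambda>i. z ([7, 6, 1, 0, 2, 3, 4, 5] ! i))"
        "gale_pattern 1 (- 1) 1 z \<Longrightarrow> gale_pattern (sgn (a k1)) (sgn (a k2)) (sgn (a k3))
          (\<lambda>i. z ([3, 2, 4, 5, 6, 7, 1, 0] ! i))"
        using 4 by (simp_all add: gale_pattern_def)
    qed (simp add: ball_lessThan_8)
  qed
qed

lemma strict_dominance_at_rays:
  "b k2 < b k1" "b k3 < b k2"
  "b k3 + \<sigma> * c k3 < b k1 + \<sigma> * c k1" "b k1 + \<tau> * c k1 < b k2 + \<tau> * c k2"
proof -
  have u: "0 < c k2 - c k1" and v: "0 < c k3 - c k2" using c_less by auto
  have "0 < \<sigma> * (c k2 - c k1)" "0 < \<tau> * (c k3 - c k2)" using u v slopes by simp_all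
  then show "b k2 < b k1" "b k3 < b k2" using b12 b23 by linarith+
  have "\<sigma> * (c k3 - c k2) < \<tau> * (c k3 - c k2)" "\<sigma> * (c k2 - c k1) < \<tau> * (c k2 - c k1)"
    using u v slopes by simp_all
  then show "b k3 + \<sigma> * c k3 < b k1 + \<sigma> * c k1" "b k1 + \<tau> * c k1 < b k2 + \<tau> * c k2"
    using b12 b23 by (simp_all add: algebra_simps)
qed

text \<open>
  In the remaining sign patterns no \<open>+\<close> precedes a \<open>-\<close>. The incentives of player 1 then pull all weight
  towards the ray at which the sign changes, or to an end of the quadrant if it never does.
\<close>

lemma point_or_octagonal: "(\<exists>p. ce_region a b c = {p}) \<or> octagonal (ce_region a b c)"
proof -
  note b_less = strict_dominance_at_rays(1,2)
  consider (top) "0 < a k1" "0 < a k2" "0 < a k3" | (bottom) "a k1 < 0" "a k2 < 0" "a k3 < 0"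
    | (ray12) "a k1 < 0" "0 < a k2" "0 < a k3" | (ray23) "a k1 < 0" "a k2 < 0" "0 < a k3"
    | (octagonal) "0 < a k1 \<and> a k2 < 0 \<or> 0 < a k2 \<and> a k3 < 0"
    using a_nonzero by linarith
  then show ?thesis
  proof cases
    case top
    have "\<exists>p. ce_region a b c = {p}"
    proof (rule ce_region_point_top_row[of k1])
      show "b l < b k1" if "l \<noteq> k1" for l
        using that b_less all3[of "\<lambda>l. l \<noteq> k1 \<longrightarrow> b l < b k1"] by auto
      show "0 < a l \<or> p $ 1 $ l = 0 \<and> p $ 2 $ l = 0" for p :: "real ^ 3 ^ 2" and l
        using top all3[of "\<lambda>l. 0 < a l"] by auto
    qed (rule top)
    then show ?thesis ..
  next
    case bottom
    have "\<exists>p. ce_region a b c = {p}"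
    proof (rule ce_region_point_bottom_row[of k3])
      show "c l < c k3" if "l \<noteq> k3" for l
        using that c_less all3[of "\<lambda>l. l \<noteq> k3 \<longrightarrow> c l < c k3"] by auto
      show "a l < 0 \<or> p $ 1 $ l = 0 \<and> p $ 2 $ l = 0" for p :: "real ^ 3 ^ 2" and l
        using bottom all3[of "\<lambda>l. a l < 0"] by auto
    qed (rule bottom)
    then show ?thesis ..
  next
    case ray12
    have "\<exists>p. ce_region a b c = {p}"
      by (rule ce_region_point_mixed[of k1 k2 k3 a c \<sigma> b])
         (use distinct ray12 c_less slopes b12 strict_dominance_at_rays in auto)
    then show ?thesis ..
  next
    case ray23
    have "\<exists>p. ce_region a b c = {p}"
      by (rule ce_region_point_mixed[of k2 k3 k1 a c \<tau> b])
         (use distinct ray23 c_less slopes b23 strict_dominance_at_rays in auto)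
    then show ?thesis ..
  next
    case octagonal
    then show ?thesis using octagonal_ce_region by blast
  qed
qed

end

section \<open>Classification of generic games with three columns\<close>

lemma nonneg_combination_zero:
  fixes u v x y :: real
  assumes "u < 0" "v < 0" "0 \<le> x" "0 \<le> y" "0 \<le> u * x + v * y"
  shows "x = 0 \<and> y = 0"
proof -
  have "u * x \<le> 0" "v * y \<le> 0" using assms by (auto simp: mult_le_0_iff)
  then have "u * x = 0" "v * y = 0" using assms(5) by linarith+
  then show ?thesis using assms by auto
qed

text \<open>
  With \<open>k2\<close> never a best reply, the signs at \<open>k1\<close> and \<open>k3\<close> decide: a change from \<open>+\<close> to \<open>-\<close> gives a
  game with two columns, and the other three patterns give a point.
\<close>

lemma two_sectors_cases:
  fixes a b c :: "3 \<Rightarrow> real"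
  assumes d: "k1 \<noteq> k2" "k1 \<noteq> k3" "k2 \<noteq> k3" and a: "\<forall>k. a k \<noteq> 0"
    and b: "b k2 < b k1" "b k3 < b k1" and c: "c k1 < c k3" "c k2 < c k3"
    and never: "\<And>x y. 0 \<le> x \<Longrightarrow> 0 \<le> y \<Longrightarrow>
      \<forall>l. 0 \<le> (b k2 - b l) * x + (c k2 - c l) * y \<Longrightarrow> x = 0 \<and> y = 0"
  shows "(\<exists>p. ce_region a b c = {p}) \<or>
    (\<exists>a' b' c' :: 2 \<Rightarrow> real. aff_dim (ce_region a' b' c') = 3 \<and>
       combinatorially_equivalent (ce_region a' b' c') (ce_region a b c))"
proof -
  note all3 = all_UNIV_3[OF d]
  have zero: "p $ 1 $ k2 = 0 \<and> p $ 2 $ k2 = 0" if "p \<in> ce_region a b c" for p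
    using that by (intro never) (auto simp: ce_region_def)
  consider "0 < a k1" "0 < a k3" | "a k1 < 0" "a k3 < 0" | "a k1 < 0" "0 < a k3" | "0 < a k1" "a k3 < 0"
    using spec[OF a, of k1] spec[OF a, of k3] by linarith
  then show ?thesis
  proof cases
    case 1
    have "\<exists>p. ce_region a b c = {p}"
    proof (rule ce_region_point_top_row[of k1])
      show "b l < b k1" if "l \<noteq> k1" for l
        using that b all3[of "\<lambda>l. l \<noteq> k1 \<longrightarrow> b l < b k1"] by auto
      show "0 < a l \<or> p $ 1 $ l = 0 \<and> p $ 2 $ l = 0" if "p \<in> ce_region a b c" for p l
        using 1 zero[OF that] all3[of "\<lambda>l. 0 < a l \<or> p $ 1 $ l = 0 \<and> p $ 2 $ l = 0"] by auto
    qed (rule 1)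
    then show ?thesis ..
  next
    case 2
    have "\<exists>p. ce_region a b c = {p}"
    proof (rule ce_region_point_bottom_row[of k3])
      show "c l < c k3" if "l \<noteq> k3" for l
        using that c all3[of "\<lambda>l. l \<noteq> k3 \<longrightarrow> c l < c k3"] by auto
      show "a l < 0 \<or> p $ 1 $ l = 0 \<and> p $ 2 $ l = 0" if "p \<in> ce_region a b c" for p l
        using 2 zero[OF that] all3[of "\<lambda>l. a l < 0 \<or> p $ 1 $ l = 0 \<and> p $ 2 $ l = 0"] by auto
    qed (rule 2)
    then show ?thesis ..
  next
    case 3
    define \<rho> where "\<rho> = (b k1 - b k3) / (c k3 - c k1)"
    have \<rho>: "0 < \<rho>" "b k1 - b k3 = \<rho> * (c k3 - c k1)" using b c by (auto simp: \<rho>_def)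
    have "b k2 + \<rho> * c k2 < b k1 + \<rho> * c k1"
    proof (rule ccontr)
      assume "\<not> ?thesis"
      then have "\<forall>l. 0 \<le> (b k2 - b l) * 1 + (c k2 - c l) * \<rho>"
        using \<rho>(2) unfolding all3 by (simp add: algebra_simps)
      then show False using never[of 1 \<rho>] \<rho>(1) by simp
    qed
    then have "\<exists>p. ce_region a b c = {p}"
      by (intro ce_region_point_mixed[of k1 k3 k2 a c \<rho> b]) (use d 3 a b c \<rho> in auto)
    then show ?thesis ..
  next
    case 4
    define \<kappa> :: "2 \<Rightarrow> 3" where "\<kappa> i = (if i = 1 then k1 else k3)" for i
    have "inj \<kappa>"
      using d(2) by (auto simp: inj_def forall_2 \<kappa>_def)
    moreover have "k = k2" if "k \<notin> range \<kappa>" for k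
    proof -
      have "k1 = \<kappa> 1" "k3 = \<kappa> 2" by (simp_all add: \<kappa>_def)
      then have "k1 \<in> range \<kappa>" "k3 \<in> range \<kappa>" by blast+
      then show ?thesis using that UNIV_3_eq[OF d] by blast
    qed
    ultimately have "combinatorially_equivalent (ce_region (a \<circ> \<kappa>) (b \<circ> \<kappa>) (c \<circ> \<kappa>)) (ce_region a b c)"
      using never by (intro ce_region_delete_columns) blast+
    moreover have "aff_dim (ce_region (a \<circ> \<kappa>) (b \<circ> \<kappa>) (c \<circ> \<kappa>)) = 3"
      by (rule aff_dim_ce_region_2) (use 4 b c in \<open>simp_all add: \<kappa>_def\<close>)
    ultimately show ?thesis by blast
  qed
qed

lemma ex_strict_max:
  fixes f :: "'m::finite \<Rightarrow> real"
  assumes "inj f"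
  shows "\<exists>k. \<forall>l. l \<noteq> k \<longrightarrow> f l < f k"
proof -
  have "Max (range f) \<in> range f" by (rule Max_in) auto
  then obtain k where k: "Max (range f) = f k" by blast
  have "f l < f k" if "l \<noteq> k" for l
  proof -
    have "f l \<le> f k" using Max_ge[of "range f" "f l"] k by simp
    moreover have "f l \<noteq> f k" using assms that by (auto dest: injD)
    ultimately show ?thesis by simp
  qed
  then show ?thesis by blast
qed

text \<open>
  The columns \<open>k1\<close> and \<open>k3\<close> that are best against the two pure strategies of player 1 have sectors at
  the two ends of the quadrant. If they differ, the third column \<open>k2\<close> has a sector between them
  exactly when it beats \<open>k1\<close> from a slope \<open>\<sigma>\<close> on and loses against \<open>k3\<close> from a larger slope \<open>\<tau>\<close> on;
  the determinant condition excludes \<open>\<sigma> = \<tau>\<close>.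
\<close>

lemma ce_region_3_cases:
  fixes a b c :: "3 \<Rightarrow> real"
  assumes a: "\<forall>k. a k \<noteq> 0" and b: "inj b" and c: "inj c"
    and det: "\<And>k l m. k \<noteq> l \<Longrightarrow> k \<noteq> m \<Longrightarrow> l \<noteq> m \<Longrightarrow>
      (b k - b l) * (c m - c l) \<noteq> (b l - b m) * (c l - c k)"
  shows "(\<exists>p. ce_region a b c = {p}) \<or> octagonal (ce_region a b c) \<or>
    (\<exists>a' b' c' :: 2 \<Rightarrow> real. aff_dim (ce_region a' b' c') = 3 \<and>
       combinatorially_equivalent (ce_region a' b' c') (ce_region a b c))"
proof -
  obtain k1 where k1: "\<And>l. l \<noteq> k1 \<Longrightarrow> b l < b k1" using ex_strict_max[OF b] by blast
  obtain k3 where k3: "\<And>l. l \<noteq> k3 \<Longrightarrow> c l < c k3" using ex_strict_max[OF c] by blast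
  show ?thesis
  proof (cases "k1 = k3")
    case True
    have zero: "p $ 1 $ l = 0 \<and> p $ 2 $ l = 0" if "p \<in> ce_region a b c" "l \<noteq> k1" for p l
      using that k1[OF that(2)] k3[of l] True
      by (intro nonneg_combination_zero[of "b l - b k1" "c l - c k1"]) (auto simp: ce_region_def)
    have "\<exists>p. ce_region a b c = {p}"
    proof (cases "0 < a k1")
      case True
      have "0 < a l \<or> p $ 1 $ l = 0 \<and> p $ 2 $ l = 0" if "p \<in> ce_region a b c" for p l
        using zero[OF that] True by (cases "l = k1") auto
      then show ?thesis using k1 True by (intro ce_region_point_top_row[of k1])
    next
      case False
      then have neg: "a k1 < 0" using spec[OF a, of k1] by simp
      have "a l < 0 \<or> p $ 1 $ l = 0 \<and> p $ 2 $ l = 0" if "p \<in> ce_region a b c" for p l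
        using zero[OF that] neg by (cases "l = k1") auto
      then show ?thesis using k3 neg \<open>k1 = k3\<close> by (intro ce_region_point_bottom_row[of k1]) simp_all
    qed
    then show ?thesis ..
  next
    case False
    obtain k2 where k2: "k2 \<noteq> k1" "k2 \<noteq> k3"
    proof -
      have "card {k1, k3} < CARD(3)" using False by simp
      then have "{k1, k3} \<noteq> UNIV" by force
      then show thesis using that by blast
    qed
    have d: "k1 \<noteq> k2" "k1 \<noteq> k3" "k2 \<noteq> k3" using k2 False by auto
    have ineq: "b k2 < b k1" "b k3 < b k1" "c k1 < c k3" "c k2 < c k3" using k1 k3 d by auto
    have two: ?thesis if never: "\<And>x y. 0 \<le> x \<Longrightarrow> 0 \<le> y \<Longrightarrow>
        0 \<le> (b k2 - b k1) * x + (c k2 - c k1) * y \<Longrightarrow>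
        0 \<le> (b k2 - b k3) * x + (c k2 - c k3) * y \<Longrightarrow> x = 0 \<and> y = 0"
    proof -
      have "x = 0 \<and> y = 0" if "0 \<le> x" "0 \<le> y"
        "\<forall>l. 0 \<le> (b k2 - b l) * x + (c k2 - c l) * y" for x y
        using never that by blast
      from two_sectors_cases[OF d a ineq this] show ?thesis by blast
    qed
    have "c k2 \<noteq> c k1" "b k2 \<noteq> b k3" using b c d by (auto dest: injD)
    then consider (c) "c k2 < c k1" | (b) "b k2 < b k3" | (mid) "c k1 < c k2" "b k3 < b k2" by linarith
    then show ?thesis
    proof cases
      case c
      show ?thesis
        by (rule two) (rule nonneg_combination_zero[of "b k2 - b k1" "c k2 - c k1"], use c ineq in auto)
    next
      case b
      show ?thesis
        by (rule two) (rule nonneg_combination_zero[of "b k2 - b k3" "c k2 - c k3"], use b ineq in auto)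
    next
      case mid
      define \<sigma> where "\<sigma> = (b k1 - b k2) / (c k2 - c k1)"
      define \<tau> where "\<tau> = (b k2 - b k3) / (c k3 - c k2)"
      have \<sigma>: "0 < \<sigma>" "b k1 - b k2 = \<sigma> * (c k2 - c k1)" using mid ineq by (auto simp: \<sigma>_def)
      have \<tau>: "0 < \<tau>" "b k2 - b k3 = \<tau> * (c k3 - c k2)" using mid ineq by (auto simp: \<tau>_def)
      have "\<sigma> \<noteq> \<tau>" using det[OF d] unfolding \<sigma>(2) \<tau>(2) by auto
      then consider "\<sigma> < \<tau>" | "\<tau> < \<sigma>" by linarith
      then show ?thesis
      proof cases
        case 1
        interpret three_sectors a b c \<sigma> \<tau> k1 k2 k3
          by unfold_locales (use d 1 \<sigma> \<tau> mid ineq a in auto)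
        show ?thesis using point_or_octagonal by blast
      next
        case 2
        show ?thesis
        proof (rule two)
          fix x y :: real
          assume xy: "0 \<le> x" "0 \<le> y" and k21: "0 \<le> (b k2 - b k1) * x + (c k2 - c k1) * y"
            and k23: "0 \<le> (b k2 - b k3) * x + (c k2 - c k3) * y"
          have "b k2 - b k1 = - (\<sigma> * (c k2 - c k1))" using \<sigma>(2) by simp
          with k21 have "0 \<le> (c k2 - c k1) * (y - \<sigma> * x)" by (simp only:) (simp add: algebra_simps)
          then have "\<sigma> * x \<le> y" using mid by (simp add: zero_le_mult_iff)
          moreover have "0 \<le> (c k3 - c k2) * (\<tau> * x - y)"
            using k23 unfolding \<tau>(2) by (simp add: algebra_simps)
          then have "y \<le> \<tau> * x" using ineq by (simp add: zero_le_mult_iff)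
          ultimately have "\<sigma> * x \<le> \<tau> * x" "y \<le> \<tau> * x" by linarith+
          moreover have "x = 0" using \<open>\<sigma> * x \<le> \<tau> * x\<close> 2 xy by (simp add: mult_le_cancel_right)
          ultimately show "x = 0 \<and> y = 0" using xy by simp
        qed
      qed
    qed
  qed
qed

lemma bounded_ce_region: "bounded (ce_region a b c)"
proof -
  have "norm p \<le> 1" if "p \<in> ce_region a b c" for p
  proof -
    have "norm p \<le> (\<Sum>j\<in>UNIV. norm (p $ j))" unfolding norm_vec_def by (rule L2_set_le_sum) simp
    also have "\<dots> \<le> (\<Sum>j\<in>UNIV. \<Sum>k\<in>UNIV. \<bar>p $ j $ k\<bar>)" by (intro sum_mono norm_le_l1_cart)
    also have "\<dots> = total p" using that by (simp add: sum_2 total_def ce_region_def sum.distrib)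
    also have "\<dots> = 1" using that by (simp add: ce_region_def)
    finally show ?thesis .
  qed
  then show ?thesis by (rule boundedI)
qed

lemma polytope_octagonal_ce_region:
  assumes "octagonal (ce_region a b c)"
  shows "polytope (ce_region a b c)"
proof -
  obtain f where "\<forall>i\<in>{..<8::nat}. linear (f i)" "ce_region a b c = cone_slice total {..<8} f"
    using assms unfolding octagonal_def by (elim exE conjE)
  then show ?thesis
    using polyhedron_cone_slice[OF linear_total finite_lessThan] bounded_ce_region[of a b c]
    by (simp add: polytope_eq_bounded_polyhedron)
qed

theorem theorem5p9:
  shows "\<exists>T :: (real ^ 3 ^ 2) set. polytope T \<and> aff_dim T = 5 \<and>
    (\<forall>X1 X2 :: real ^ 3 ^ 2. generic_payoffs X1 X2 \<longrightarrow>
       (\<exists>p. correlated_equilibrium_polytope X1 X2 = {p}) \<or>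
       (aff_dim (correlated_equilibrium_polytope X1 X2) = 5 \<and>
        combinatorially_equivalent (correlated_equilibrium_polytope X1 X2) T) \<or>
       (\<exists>X1' X2' :: real ^ 2 ^ 2.
          aff_dim (correlated_equilibrium_polytope X1' X2') = 3 \<and>
          combinatorially_equivalent
            (correlated_equilibrium_polytope X1' X2') (correlated_equilibrium_polytope X1 X2)))"
proof -
  \<comment> \<open>a game with three sectors, bounded by the slopes \<open>1 / 2\<close> and \<open>2\<close>, and signs \<open>+, -, +\<close>\<close>
  define a0 b0 c0 :: "3 \<Rightarrow> real" where
    "a0 k = (if k = 2 then - 1 else 1)" and
    "b0 k = (if k = 1 then 3 else if k = 2 then 2 else 0)" and
    "c0 k = (if k = 1 then 0 else if k = 2 then 2 else 3)" for k
  interpret T: three_sectors a0 b0 c0 "1 / 2" 2 1 2 3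
    by unfold_locales (simp_all add: a0_def b0_def c0_def)
  have T: "octagonal (ce_region a0 b0 c0)"
    by (rule T.octagonal_ce_region) (simp add: a0_def)
  have "(\<exists>p. correlated_equilibrium_polytope X1 X2 = {p}) \<or>
       (aff_dim (correlated_equilibrium_polytope X1 X2) = 5 \<and>
        combinatorially_equivalent (correlated_equilibrium_polytope X1 X2) (ce_region a0 b0 c0)) \<or>
       (\<exists>X1' X2' :: real ^ 2 ^ 2.
          aff_dim (correlated_equilibrium_polytope X1' X2') = 3 \<and>
          combinatorially_equivalent
            (correlated_equilibrium_polytope X1' X2') (correlated_equilibrium_polytope X1 X2))"
    if gen: "generic_payoffs X1 X2" for X1 X2 :: "real ^ 3 ^ 2"
  proof -
    define a b c where "a k = X1 $ 1 $ k - X1 $ 2 $ k" and "b = ($) (X2 $ 1)" and "c = ($) (X2 $ 2)" for k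
    have P: "correlated_equilibrium_polytope X1 X2 = ce_region a b c"
      unfolding correlated_equilibrium_polytope_eq_ce_region a_def b_def c_def ..
    have "\<forall>k. a k \<noteq> 0"
      using gen by (simp add: generic_payoffs_def Y1_def a_def)
    moreover have bc: "b 1 \<noteq> b 2" "b 1 \<noteq> b 3" "b 2 \<noteq> b 3" "c 1 \<noteq> c 2" "c 1 \<noteq> c 3" "c 2 \<noteq> c 3"
      using gen by (auto simp: generic_payoffs_def Y2_def b_def c_def forall_2)
    then have "inj b" "inj c" unfolding inj_def forall_3 by auto
    \<comment> \<open>up to sign, the determinant condition is the same for all orders of the three columns\<close>
    moreover define D where "D = (c 1 - c 2) * (b 1 - b 3) - (b 1 - b 2) * (c 1 - c 3)"
    have "D \<noteq> 0" using gen by (simp add: generic_payoffs_def Y2_def b_def c_def D_def)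
    have "(b k - b l) * (c m - c l) \<noteq> (b l - b m) * (c l - c k)"
      if klm: "k \<noteq> l" "k \<noteq> m" "l \<noteq> m" for k l m
    proof -
      have "(b k - b l) * (c m - c l) - (b l - b m) * (c l - c k) \<in> {D, - D}"
        using klm exhaust_3[of k] exhaust_3[of l] exhaust_3[of m]
        by (elim disjE) (simp_all add: D_def algebra_simps)
      then show ?thesis using \<open>D \<noteq> 0\<close> by auto
    qed
    ultimately consider (point) "\<exists>p. ce_region a b c = {p}" | (full) "octagonal (ce_region a b c)"
      | (small) a' b' c' :: "2 \<Rightarrow> real" where "aff_dim (ce_region a' b' c') = 3"
        "combinatorially_equivalent (ce_region a' b' c') (ce_region a b c)"
      using ce_region_3_cases[of a b c] by blast
    then show ?thesis
    proof cases
      case point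
      then show ?thesis unfolding P ..
    next
      case full
      then show ?thesis
        unfolding P using aff_dim_octagonal[OF full] combinatorially_equivalent_if_octagonal[OF full T] by simp
    next
      case small
      define X1' X2' :: "real ^ 2 ^ 2" where
        "X1' = (\<chi> j k. if j = 1 then a' k else 0)" and "X2' = (\<chi> j k. if j = 1 then b' k else c' k)"
      have "(\<lambda>k. X1' $ 1 $ k - X1' $ 2 $ k) = a'" "($) (X2' $ 1) = b'" "($) (X2' $ 2) = c'"
        by (simp_all add: X1'_def X2'_def fun_eq_iff)
      then have "correlated_equilibrium_polytope X1' X2' = ce_region a' b' c'"
        unfolding correlated_equilibrium_polytope_eq_ce_region by simp
      then show ?thesis using small unfolding P by metis
    qed
  qed
  then show ?thesis
    using polytope_octagonal_ce_region[OF T] aff_dim_octagonal[OF T]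
    by (intro exI[of _ "ce_region a0 b0 c0"]) simp
qed

end
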